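(* Let $\hat{A}\in\mathbb{DC}_n^{\mathrm{CM}}$ with $r=\operatorname{Rank}(\hat{A})$. Then there exist $\hat{U}\in\mathbb{DC}_n^{U}$, $K\in\mathbb{DC}^{r\times r}$ invertible and $L\in\mathbb{DC}^{r\times(n-r)}$ satisfying $KK^*+LL^*=I_r$, and $\Sigma_1=\operatorname{diag}(\mu_1,\ldots,\mu_r)$ with $\mu_1\ge\cdots\ge\mu_r$ positive appreciable dual numbers, such that $\hat A=\hat U\begin{bmatrix}\Sigma_1K&\Sigma_1L\\0&0\end{bmatrix}\hat U^*$ and $$\hat{A}^{\#}=\hat{U}\begin{bmatrix}K^{-1}\Sigma_1^{-1}&K^{-1}\Sigma_1^{-1}K^{-1}L\\0&0\end{bmatrix}\hat{U}^*.$$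
   Context: Dual complex numbers are $\hat a=a_s+\epsilon a_d$ with $a_s,a_d\in\mathbb{C}$, $\epsilon\ne0$, $\epsilon^2=0$, $\epsilon$ commuting with scalars; they form the ring $\mathbb{DC}$. A dual number is such an element with $a_s,a_d\in\mathbb{R}$. It is appreciable if $a_s\neq0$ and infinitesimal if $a_s=0$. Dual numbers are totally ordered by: $\hat a\le\hat b$ iff $a_s<b_s$, or $a_s=b_s$ and $a_d\le b_d$; $\hat a$ is positive if $\hat a>0$. A matrix $\hat A\in\mathbb{DC}^{m\times n}$ is written $\hat A=A_s+\epsilon A_d$ with $A_s,A_d\in\mathbb{C}^{m\times n}$; $\hat A^*=A_s^*+\epsilon A_d^*$. $\mathbb{DC}_n^U$ is the set of $\hat U\in\mathbb{DC}^{n\times n}$ with $\hat U^{-1}=\hat U^*$. Dual SVD: every $\hat A\in\mathbb{DC}^{m\times n}$ can be written $\hat A=\hat P\begin{bmatrix}\Sigma_0&0\\0&0\end{bmatrix}\hat V^*$ with $\hat P\in\mathbb{DC}_m^U$, $\hat V\in\mathbb{DC}_n^U$, $\Sigma_0=\operatorname{diag}(\mu_1,\ldots,\mu_t)$ with positive dual number entries in nonincreasing order (appreciable ones first, then infinitesimal ones), where $\Sigma_0$ is uniquely determined by $\hat A$; $\operatorname{Rank}(\hat A)=t$. $\mathbb{DC}_n^{\mathrm{CM}}=\{\hat A\in\mathbb{DC}^{n\times n}:\mathcal R(\hat A^2)=\mathcal R(\hat A)\}$, where $\mathcal R(\hat A)=\{\hat Ax:x\in\mathbb{DC}^n\}$.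 For $\hat A\in\mathbb{DC}_n^{\mathrm{CM}}$ the dual group inverse (DGGI) $\hat A^{\#}$ is the unique $\hat X$ with $\hat A\hat X\hat A=\hat A$, $\hat X\hat A\hat X=\hat X$, $\hat A\hat X=\hat X\hat A$. *)

theory Defs
  imports
    Complex_Main
    "Jordan_Normal_Form.Matrix"
    "Jordan_Normal_Form.Conjugate"
begin

section \<open>Dual numbers over a commutative ring\<close>

datatype 'a dual = Dual (std_part: 'a) (dual_part: 'a)

text \<open>
  \<^term>\<open>Dual a b\<close> stands for the dual element with standard part \<^term>\<open>a\<close> and dual part
  \<^term>\<open>b\<close>, that is a + eps * b with eps squared equal to 0.  Dual complex numbers are the type
  \<^typ>\<open>complex dual\<close>, dual numbers are the type \<^typ>\<open>real dual\<close>.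
\<close>

instantiation dual :: (comm_ring_1) comm_ring_1
begin

definition zero_dual :: "'a dual" where "0 = Dual 0 0"
definition one_dual :: "'a dual" where "1 = Dual 1 0"
definition plus_dual :: "'a dual \<Rightarrow> 'a dual \<Rightarrow> 'a dual" where
  "x + y = Dual (std_part x + std_part y) (dual_part x + dual_part y)"
definition uminus_dual :: "'a dual \<Rightarrow> 'a dual" where
  "- x = Dual (- std_part x) (- dual_part x)"
definition minus_dual :: "'a dual \<Rightarrow> 'a dual \<Rightarrow> 'a dual" where
  "x - y = Dual (std_part x - std_part y) (dual_part x - dual_part y)"
definition times_dual :: "'a dual \<Rightarrow> 'a dual \<Rightarrow> 'a dual" where
  "x * y = Dual (std_part x * std_part y)
                (std_part x * dual_part y + dual_part x * std_part y)"

instance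
  by standard
    (auto simp: zero_dual_def one_dual_def plus_dual_def uminus_dual_def minus_dual_def
      times_dual_def algebra_simps)

end

definition eps :: "'a::comm_ring_1 dual" where
  "eps = Dual 0 1"

lemma eps_nonzero: "eps \<noteq> 0"
  by (simp add: eps_def zero_dual_def)

lemma eps_squared: "eps * eps = 0"
  by (simp add: eps_def zero_dual_def times_dual_def)

lemma Dual_eq_eps: "Dual a b = Dual a 0 + eps * Dual b 0"
  by (simp add: eps_def plus_dual_def times_dual_def)

instantiation dual :: ("{comm_ring_1, conjugatable_ring}") conjugatable_ring
begin

definition conjugate_dual :: "'a dual \<Rightarrow> 'a dual" where
  "conjugate x = Dual (conjugate (std_part x)) (conjugate (dual_part x))"

instance
  by standard
    (auto simp: conjugate_dual_def zero_dual_def plus_dual_def uminus_dual_def times_dual_def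
      conjugate_dist_add conjugate_dist_mul conjugate_neg dual.expand intro: dual.expand)

end

text \<open>The lexicographic order; it is used only for \<^typ>\<open>real dual\<close>.\<close>

instantiation dual :: (linorder) linorder
begin

definition less_eq_dual :: "'a dual \<Rightarrow> 'a dual \<Rightarrow> bool" where
  "x \<le> y \<longleftrightarrow> std_part x < std_part y \<or> std_part x = std_part y \<and> dual_part x \<le> dual_part y"
definition less_dual :: "'a dual \<Rightarrow> 'a dual \<Rightarrow> bool" where
  "x < y \<longleftrightarrow> x \<le> y \<and> \<not> y \<le> (x :: 'a dual)"

instance
  by standard (auto simp: less_eq_dual_def less_dual_def intro: dual.expand)

end

definition appreciable :: "'a::zero dual \<Rightarrow> bool" where
  "appreciable x \<longleftrightarrow> std_part x \<noteq> 0"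

definition dc_of_dual :: "real dual \<Rightarrow> complex dual" where
  "dc_of_dual x = Dual (complex_of_real (std_part x)) (complex_of_real (dual_part x))"

section \<open>Matrices of dual complex numbers\<close>

text \<open>
  The adjoint of the Schur decomposition theory requires a \<^class>\<open>conjugatable_field\<close>, which
  the dual complex numbers are not.  Entrywise conjugation acts separately on the standard and the dual part.
\<close>

definition adj :: "complex dual mat \<Rightarrow> complex dual mat" where
  "adj A = mat (dim_col A) (dim_row A) (\<lambda>(i, j). conjugate (A $$ (j, i)))"

text \<open>Meaningful only for matrices satisfying \<^const>\<open>invertible_mat\<close>.\<close>

definition mat_inv :: "'a::comm_ring_1 mat \<Rightarrow> 'a mat" where
  "mat_inv A = (THE B. inverts_mat A B \<and> inverts_mat B A)"

definition dc_unitary :: "nat \<Rightarrow> complex dual mat set" where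
  "dc_unitary n = {U \<in> carrier_mat n n. invertible_mat U \<and> mat_inv U = adj U}"

definition dc_diag :: "nat \<Rightarrow> (nat \<Rightarrow> real dual) \<Rightarrow> complex dual mat" where
  "dc_diag t \<mu> = mat_diag t (\<lambda>i. dc_of_dual (\<mu> i))"

text \<open>
  Singular values are indexed from 0, so \<^term>\<open>\<mu> i\<close> is the (i+1)-st one and only the values at
  indices below \<^term>\<open>t\<close> matter.  In the lexicographic order a nonincreasing list of positive dual
  numbers automatically has its appreciable members before the infinitesimal ones.
\<close>

definition is_dual_svd ::
  "complex dual mat \<Rightarrow> complex dual mat \<Rightarrow> nat \<Rightarrow> (nat \<Rightarrow> real dual) \<Rightarrow> complex dual mat \<Rightarrow> bool"
where
  "is_dual_svd A P t \<mu> V \<longleftrightarrow>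
     (let m = dim_row A; n = dim_col A in
      P \<in> dc_unitary m \<and> V \<in> dc_unitary n \<and> t \<le> m \<and> t \<le> n \<and>
      (\<forall>i<t. 0 < \<mu> i) \<and> (\<forall>i j. i \<le> j \<and> j < t \<longrightarrow> \<mu> j \<le> \<mu> i) \<and>
      A = P * four_block_mat (dc_diag t \<mu>) (0\<^sub>m t (n - t)) (0\<^sub>m (m - t) t) (0\<^sub>m (m - t) (n - t))
            * adj V)"

definition dual_rank :: "complex dual mat \<Rightarrow> nat" where
  "dual_rank A = (THE t. \<exists>P \<mu> V. is_dual_svd A P t \<mu> V)"

definition mat_range :: "complex dual mat \<Rightarrow> complex dual vec set" where
  "mat_range A = {A *\<^sub>v x | x. x \<in> carrier_vec (dim_col A)}"

definition dc_CM :: "nat \<Rightarrow> complex dual mat set" where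
  "dc_CM n = {A \<in> carrier_mat n n. mat_range (A ^\<^sub>m 2) = mat_range A}"

definition is_group_inv :: "complex dual mat \<Rightarrow> complex dual mat \<Rightarrow> bool" where
  "is_group_inv A X \<longleftrightarrow>
     X \<in> carrier_mat (dim_row A) (dim_row A) \<and> A * X * A = A \<and> X * A * X = X \<and> A * X = X * A"

definition dggi :: "complex dual mat \<Rightarrow> complex dual mat" where
  "dggi A = (THE X. is_group_inv A X)"

text \<open>At most one candidate satisfies the descriptions of \<^const>\<open>mat_inv\<close> and \<^const>\<open>dggi\<close>.\<close>

lemma mat_inv_eqI:
  fixes A :: "'a::comm_ring_1 mat"
  assumes "inverts_mat A B" "inverts_mat B A"
  shows "mat_inv A = B"
  unfolding mat_inv_def
proof (rule the_equality)
  fix C assume C: "inverts_mat A C \<and> inverts_mat C A"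
  define n k where "n = dim_row A" and "k = dim_col A"
  have A: "A \<in> carrier_mat n k" by (simp add: n_def k_def)
  have B: "B \<in> carrier_mat k n" and AB: "A * B = 1\<^sub>m n" and BA: "B * A = 1\<^sub>m k"
    using assms unfolding inverts_mat_def n_def k_def
    by (metis carrier_matI index_mult_mat(2,3) index_one_mat(2,3))+
  have C': "C \<in> carrier_mat k n" and CA: "C * A = 1\<^sub>m k"
    using C unfolding inverts_mat_def n_def k_def
    by (metis carrier_matI index_mult_mat(2,3) index_one_mat(2,3))+
  have "C = C * (A * B)" using C' AB by simp
  also have "\<dots> = (C * A) * B" using A B C' by simp
  also have "\<dots> = B" using B CA by simp
  finally show "C = B" .
qed (use assms in simp)

lemma dggi_eqI:
  assumes A: "A \<in> carrier_mat n n" and "is_group_inv A X"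
  shows "dggi A = X"
  unfolding dggi_def
proof (rule the_equality)
  fix Y assume "is_group_inv A Y"
  then have Y: "Y \<in> carrier_mat n n" "A * Y * A = A" "Y * A * Y = Y" "A * Y = Y * A"
    using A by (auto simp: is_group_inv_def)
  have X: "X \<in> carrier_mat n n" "A * X * A = A" "X * A * X = X" "A * X = X * A"
    using assms by (auto simp: is_group_inv_def)
  have "X * A = X * (A * Y * A)" using Y by simp
  also have "\<dots> = (X * A) * (Y * A)" using A X(1) Y(1) by (simp add: assoc_mult_mat[of _ n n _ n _ n])
  also have "\<dots> = (A * X) * (A * Y)" using X Y by simp
  also have "\<dots> = (A * X * A) * Y" using A X(1) Y(1) by (simp add: assoc_mult_mat[of _ n n _ n _ n])
  also have "\<dots> = A * Y" using X by simp
  finally have XA: "X * A = A * Y" .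
  have "Y = (Y * A) * Y" using Y by simp
  also have "\<dots> = (X * A) * Y" using XA Y by simp
  also have "\<dots> = X * (A * Y)" using A X(1) Y(1) by (simp add: assoc_mult_mat[of _ n n _ n _ n])
  also have "\<dots> = X * (X * A)" using XA by simp
  also have "\<dots> = X * (A * X)" using X by simp
  also have "\<dots> = X" using A X(1,3) by (simp add: assoc_mult_mat[of _ n n _ n _ n])
  finally show "Y = X" .
qed (use assms in simp)

end

theory Submission
  imports Defs "Jordan_Normal_Form.Schur_Decomposition" "Jordan_Normal_Form.Spectral_Radius"
    "HOL-Combinatorics.Permutations"
begin

text \<open>
  Let A = A * A * X, which is what equality of the ranges of A and its square means, and let
  A = P D V* be a dual SVD with D = diag(S, 0). For W = V* P this gives A = P (D W) P*, where D W has
  the rows S K and S L on top and zeros below, K and L being the top blocks of W; since W is unitary,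
  K K* + L L* = 1. The equation A = A * A * X becomes S = S K S Z for some Z, whence K S Z has standard
  part 1. So K and S are invertible, and the formula for the group inverse G is checked by block
  multiplication. The trace of A G is the number of singular values, which is therefore
  independent of the chosen decomposition.

  A decomposition is obtained from A A* = P diag(l) P* by normalising those rows of P* A P for which l
  is appreciable and completing them to a unitary matrix. The other rows are infinitesimal and
  orthogonal to the former, hence zero, again because A = A * A * X. The spectral theorem for a dual
  Hermitian matrix reduces, after a perturbation argument, to the simultaneous
  diagonalisation of two commuting Hermitian matrices X and Y, that is, to that of the normal matrix X + iY.
\<close>

section \<open>Conjugate transpose and unitary matrices\<close>

lemma conjugate_one [simp]: "conjugate (1::'a::{comm_ring_1,conjugatable_ring}) = 1"
proof -
  have "conjugate (conjugate (1::'a) * 1) = conjugate (conjugate 1) * conjugate 1"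
    by (rule conjugate_dist_mul)
  thus ?thesis by simp
qed

section \<open>Inverses of square matrices over a commutative ring\<close>

lemma smult_smult_mat: "a \<cdot>\<^sub>m (b \<cdot>\<^sub>m A) = (a * b) \<cdot>\<^sub>m (A :: 'a::semigroup_mult mat)"
  by (rule eq_matI) (auto simp: mult.assoc)

lemma one_smult_mat [simp]: "1 \<cdot>\<^sub>m A = (A :: 'a::monoid_mult mat)"
  by (rule eq_matI) auto

text \<open>In place of a dimension count: \<open>det A\<close> is a unit with inverse
  \<open>det B\<close>, so the scaled adjugate is a left inverse of \<open>A\<close>, and it must
  agree with \<open>B\<close>.\<close>

lemma mat_mult_left_right_inverse_comm_ring:
  fixes A :: "'a::comm_ring_1 mat"
  assumes A: "A \<in> carrier_mat n n" and B: "B \<in> carrier_mat n n" and AB: "A * B = 1\<^sub>m n"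
  shows "B * A = 1\<^sub>m n"
proof -
  have "det A * det B = 1" using det_mult[OF A B] AB by simp
  define C where "C = det B \<cdot>\<^sub>m adj_mat A"
  have C: "C \<in> carrier_mat n n" using adj_mat(1)[OF A] by (simp add: C_def)
  have CA: "C * A = 1\<^sub>m n"
    unfolding C_def using adj_mat[OF A] A \<open>det A * det B = 1\<close>
    by (simp add: mult_smult_assoc_mat[of _ n n _ n] smult_smult_mat mult.commute)
  have "C = C * (A * B)" using AB C by simp
  also have "\<dots> = (C * A) * B" using A B C by simp
  finally show ?thesis using CA B by simp
qed

lemma mat_invertible_if_det_dvd_one:
  fixes A :: "'a::comm_ring_1 mat"
  assumes A: "A \<in> carrier_mat n n" and "det A * d = 1"
  shows "\<exists>B. B \<in> carrier_mat n n \<and> A * B = 1\<^sub>m n \<and> B * A = 1\<^sub>m n"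
proof -
  have "A * (d \<cdot>\<^sub>m adj_mat A) = 1\<^sub>m n"
    using adj_mat[OF A] A assms(2)
    by (simp add: mult_smult_distrib[of _ n n _ n] smult_smult_mat mult.commute)
  thus ?thesis
    using mat_mult_left_right_inverse_comm_ring[OF A, of "d \<cdot>\<^sub>m adj_mat A"] adj_mat(1)[OF A]
    by (intro exI[of _ "d \<cdot>\<^sub>m adj_mat A"]) simp
qed

text \<open>The same operation as \<open>adj\<close>, but over any ring with conjugation, so that
  complex and dual complex matrices share one theory.\<close>

definition cadj :: "'a::conjugatable_ring mat \<Rightarrow> 'a mat" where
  "cadj A = mat (dim_col A) (dim_row A) (\<lambda>(i, j). conjugate (A $$ (j, i)))"

lemma adj_eq_cadj: "adj = cadj"
  by (rule ext) (simp add: adj_def cadj_def)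

lemma cadj_dim [simp]: "dim_row (cadj A) = dim_col A" "dim_col (cadj A) = dim_row A"
  by (simp_all add: cadj_def)

lemma cadj_carrier [simp]: "cadj A \<in> carrier_mat m n \<longleftrightarrow> A \<in> carrier_mat n m"
  unfolding carrier_mat_def mem_Collect_eq cadj_dim by blast

lemma cadj_index [simp]:
  "i < dim_col A \<Longrightarrow> j < dim_row A \<Longrightarrow> cadj A $$ (i, j) = conjugate (A $$ (j, i))"
  by (simp add: cadj_def)

lemma cadj_cadj [simp]: "cadj (cadj A) = A"
  by (rule eq_matI) auto

lemma cadj_mult:
  fixes A B :: "'a::{comm_ring_1,conjugatable_ring} mat"
  assumes "A \<in> carrier_mat m k" "B \<in> carrier_mat k n"
  shows "cadj (A * B) = cadj B * cadj A"
  using assms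
  by (intro eq_matI)
    (auto simp: scalar_prod_def sum_conjugate conjugate_dist_mul mult.commute intro!: sum.cong)

lemma cadj_one [simp]: "cadj (1\<^sub>m n :: 'a::{comm_ring_1,conjugatable_ring} mat) = 1\<^sub>m n"
  by (rule eq_matI) auto

lemma cadj_mat_diag: "cadj (mat_diag n f) = mat_diag n (\<lambda>i. conjugate (f i))"
  by (rule eq_matI) (auto simp: mat_diag_def)

lemma mat_diag_dims [simp]: "dim_row (mat_diag n f) = n" "dim_col (mat_diag n f) = n"
  by (auto simp: mat_diag_def)

lemma mult_mat_index:
  "i < dim_row A \<Longrightarrow> j < dim_col B \<Longrightarrow> dim_col A = dim_row B \<Longrightarrow>
    (A * B) $$ (i, j) = (\<Sum>k<dim_row B. A $$ (i, k) * B $$ (k, j))"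
  by (auto simp: scalar_prod_def lessThan_atLeast0 intro!: sum.cong)

definition unitary :: "nat \<Rightarrow> 'a::{comm_ring_1,conjugatable_ring} mat \<Rightarrow> bool" where
  "unitary n U \<longleftrightarrow> U \<in> carrier_mat n n \<and> cadj U * U = 1\<^sub>m n"

lemma unitaryD:
  assumes "unitary n U"
  shows "U \<in> carrier_mat n n" "cadj U * U = 1\<^sub>m n" "U * cadj U = 1\<^sub>m n"
proof -
  show U: "U \<in> carrier_mat n n" "cadj U * U = 1\<^sub>m n"
    using assms by (simp_all add: unitary_def)
  then show "U * cadj U = 1\<^sub>m n"
    by (intro mat_mult_left_right_inverse_comm_ring[of "cadj U" n U]) simp_all
qed

lemma unitary_cancel:
  assumes U: "unitary n U" and X: "X \<in> carrier_mat n m"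
  shows "cadj U * (U * X) = X" "U * (cadj U * X) = X"
proof -
  note uD = unitaryD[OF U]
  have U': "cadj U \<in> carrier_mat n n" using uD(1) by simp
  show "cadj U * (U * X) = X"
    using assoc_mult_mat[OF U' uD(1) X, symmetric] uD(2) X by simp
  show "U * (cadj U * X) = X"
    using assoc_mult_mat[OF uD(1) U' X, symmetric] uD(3) X by simp
qed

lemma unitary_cadj: "unitary n U \<Longrightarrow> unitary n (cadj U)"
  using unitaryD(1,3)[of n U] unfolding unitary_def by (metis cadj_cadj cadj_carrier)

lemma unitary_one: "unitary n (1\<^sub>m n)"
  by (simp add: unitary_def)

lemma unitary_mult:
  assumes "unitary n U" "unitary n V"
  shows "unitary n (U * V)"
proof -
  note U = unitaryD[OF assms(1)] and V = unitaryD[OF assms(2)]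
  have "cadj (U * V) * (U * V) = cadj V * (cadj U * (U * V))"
    using U(1) V(1) by (simp add: cadj_mult[of U n n V n] assoc_mult_mat[of _ n n _ n _ n])
  also have "\<dots> = 1\<^sub>m n" using unitary_cancel(1)[OF assms(1) V(1)] V(2) by simp
  finally show ?thesis using U(1) V(1) by (simp add: unitary_def)
qed

text \<open>Uniqueness of inverses (\<open>mat_inv_eqI\<close>) turns the condition stated through
  \<open>mat_inv\<close> into a matrix equation, and back.\<close>

lemma dc_unitary_iff: "U \<in> dc_unitary n \<longleftrightarrow> unitary n U"
proof
  assume U: "U \<in> dc_unitary n"
  then obtain B where B: "inverts_mat U B" "inverts_mat B U"
    unfolding dc_unitary_def invertible_mat_def by blast
  have "cadj U = B" using mat_inv_eqI[OF B] U by (simp add: dc_unitary_def adj_eq_cadj)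
  moreover have "U \<in> carrier_mat n n" using U by (simp add: dc_unitary_def)
  ultimately show "unitary n U"
    using B(2) unfolding inverts_mat_def unitary_def by (metis cadj_dim(1) carrier_matD(2))
next
  assume U: "unitary n U"
  have "inverts_mat U (adj U)" "inverts_mat (adj U) U"
    using unitaryD[OF U] by (simp_all add: inverts_mat_def adj_eq_cadj)
  with unitaryD(1)[OF U] mat_inv_eqI[OF this] show "U \<in> dc_unitary n"
    unfolding dc_unitary_def invertible_mat_def by auto
qed

text \<open>Complete \<open>v\<close> to a basis, apply Gram-Schmidt, which keeps the first vector,
  and normalise; the factor \<open>c\<close> comes from the normalisation.\<close>

lemma unitary_extend_vec:
  fixes v :: "complex vec"
  assumes v: "v \<in> carrier_vec n" "v \<noteq> 0\<^sub>v n"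
  shows "\<exists>U c. unitary n U \<and> col U 0 = c \<cdot>\<^sub>v v"
proof -
  have n: "n > 0" using v by (cases n) auto
  interpret cof_vec_space n "TYPE(complex)" .
  define b where "b = basis_completion v"
  note bc = basis_completion[OF v, folded b_def]
  define ws where "ws = gram_schmidt n b"
  from gram_schmidt_result[OF bc(2) bc(4) bc(5) ws_def]
  have ws: "set ws \<subseteq> carrier_vec n" "corthogonal ws" "length ws = n" using bc(6) by auto
  obtain vs where "b = v # vs" using bc(6,7) n by (cases b) auto
  hence "hd ws = v" using gram_schmidt_hd[OF v(1), of vs] by (simp only: ws_def)
  moreover have "ws \<noteq> []" using ws(3) n by auto
  ultimately have ws0: "ws ! 0 = v" by (simp add: hd_conv_nth)
  \<comment> \<open>Gram-Schmidt only gives orthogonal vectors; \<open>q i\<close> is the reciprocal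
    norm of \<open>ws ! i\<close>.\<close>
  define q where "q i = complex_of_real (1 / sqrt (\<Sum>k<n. (cmod (ws ! i $ k))\<^sup>2))" for i
  have ip: "(\<Sum>k<n. ws ! i $ k * cnj (ws ! j $ k)) = ws ! i \<bullet>c ws ! j" if "i < n" "j < n" for i j
  proof -
    have "dim_vec (ws ! j) = n" using ws that by (intro carrier_vecD) auto
    thus ?thesis unfolding scalar_prod_def by (intro sum.cong) auto
  qed
  define U where "U = mat n n (\<lambda>(i, j). q j * ws ! j $ i)"
  have U: "U \<in> carrier_mat n n" by (simp add: U_def)
  have "cadj U * U = 1\<^sub>m n"
  proof (rule eq_matI)
    fix i j assume "i < dim_row (1\<^sub>m n)" "j < dim_col (1\<^sub>m n)"
    hence ij: "i < n" "j < n" by auto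
    have "(cadj U * U) $$ (i, j) = (\<Sum>k<n. cnj (q i * ws ! i $ k) * (q j * ws ! j $ k))"
      using ij by (subst mult_mat_index) (auto simp: U_def intro!: sum.cong)
    also have "\<dots> = cnj (q i) * q j * (ws ! j \<bullet>c ws ! i)"
      unfolding ip[OF ij(2,1), symmetric] sum_distrib_left by (intro sum.cong) auto
    also have "\<dots> = (if i = j then 1 else 0)"
    proof (cases "i = j")
      case False
      thus ?thesis using corthogonalD[OF ws(2), of j i] ij ws(3) by auto
    next
      case True
      define s where "s = (\<Sum>k<n. (cmod (ws ! i $ k))\<^sup>2)"
      have "ws ! i \<bullet>c ws ! i = (\<Sum>k<n. ws ! i $ k * cnj (ws ! i $ k))"
        using ij by (simp only: ip)
      also have "\<dots> = of_real s"
        unfolding s_def of_real_sum by (intro sum.cong refl) (rule complex_norm_square[symmetric])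
      finally have "ws ! i \<bullet>c ws ! i = of_real s" .
      moreover have "ws ! i \<bullet>c ws ! i \<noteq> 0" using corthogonalD[OF ws(2), of i i] ij ws(3) by auto
      ultimately have ws_s: "ws ! i \<bullet>c ws ! i = of_real s" and "s \<noteq> 0" by auto
      moreover have "s \<ge> 0" unfolding s_def by (rule sum_nonneg) simp
      ultimately have "s > 0" by simp
      have "q i = of_real (1 / sqrt s)" by (simp only: q_def s_def)
      hence "cnj (q i) * q i * of_real s = of_real (1 / sqrt s * (1 / sqrt s) * s)"
        by (simp only: complex_cnj_complex_of_real of_real_mult)
      also have "1 / sqrt s * (1 / sqrt s) * s = 1" using \<open>s > 0\<close> by simp
      finally show ?thesis by (simp add: True[symmetric] ws_s)
    qed
    finally show "(cadj U * U) $$ (i, j) = 1\<^sub>m n $$ (i, j)" using ij by simp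
  qed (auto simp: U_def)
  moreover have "col U 0 = q 0 \<cdot>\<^sub>v v"
    using n v by (intro eq_vecI) (auto simp: U_def ws0)
  ultimately show ?thesis using U by (auto simp: unitary_def)
qed

section \<open>Normal complex matrices\<close>

lemma cadj_four_block_mat:
  assumes "A \<in> carrier_mat a b" "B \<in> carrier_mat a c" "C \<in> carrier_mat d b" "D \<in> carrier_mat d c"
  shows "cadj (four_block_mat A B C D) = four_block_mat (cadj A) (cadj C) (cadj B) (cadj D)"
  using carrier_matD[OF assms(1)] carrier_matD[OF assms(2)]
    carrier_matD[OF assms(3)] carrier_matD[OF assms(4)]
  by (intro eq_matI) simp_all

lemma block_diag_mult:
  assumes "A \<in> carrier_mat a a" "A' \<in> carrier_mat a a" "D \<in> carrier_mat d d" "D' \<in> carrier_mat d d"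
  shows "four_block_mat A (0\<^sub>m a d) (0\<^sub>m d a) D * four_block_mat A' (0\<^sub>m a d) (0\<^sub>m d a) D'
    = four_block_mat (A * A') (0\<^sub>m a d) (0\<^sub>m d a) (D * D' :: 'a::comm_ring_1 mat)"
  using assms by (subst mult_four_block_mat[of _ a a _ d _ d _ _ a _ d]) simp_all

lemma unitary_block_diag:
  assumes "unitary a A" "unitary d D"
  shows "unitary (a + d) (four_block_mat A (0\<^sub>m a d) (0\<^sub>m d a) D)"
proof -
  note A = unitaryD[OF assms(1)] and D = unitaryD[OF assms(2)]
  have z: "cadj (0\<^sub>m a d) = (0\<^sub>m d a :: 'a mat)" "cadj (0\<^sub>m d a) = (0\<^sub>m a d :: 'a mat)"
    by (intro eq_matI; simp)+
  show ?thesis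
    using A D unfolding unitary_def
    by (simp add: cadj_four_block_mat[of _ a a _ d _ d] z block_diag_mult)
qed

lemma unitary_conj_diag_iff:
  assumes "unitary n U" "N \<in> carrier_mat n n" "D \<in> carrier_mat n n"
  shows "N = U * D * cadj U \<longleftrightarrow> cadj U * N * U = D"
proof -
  note U = unitaryD[OF assms(1)]
  have U': "cadj U \<in> carrier_mat n n" using U(1) by simp
  have "cadj U * (U * D * cadj U) * U = D"
    using U U' assms(3) unitary_cancel[OF assms(1), of _ n]
    by (simp add: assoc_mult_mat[of _ n n _ n _ n])
  moreover have "U * (cadj U * N * U) * cadj U = N"
    using U U' assms(2) unitary_cancel[OF assms(1), of _ n]
    by (simp add: assoc_mult_mat[of _ n n _ n _ n])
  ultimately show ?thesis by auto
qed

text \<open>Induction by deflation: conjugation by a unitary matrix whose first column is an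
  eigenvector clears the rest of the first column, normality then clears the first row, and the
  remaining block is again normal.\<close>

theorem normal_mat_unitary_diag:
  fixes N :: "complex mat"
  assumes "N \<in> carrier_mat n n" "N * cadj N = cadj N * N"
  shows "\<exists>U d. unitary n U \<and> cadj U * N * U = mat_diag n d"
  using assms
proof (induction n arbitrary: N)
  case 0
  have "cadj (1\<^sub>m 0) * N * 1\<^sub>m 0 = mat_diag 0 undefined"
    using 0(1) by (intro eq_matI) (simp_all add: mat_diag_def)
  thus ?case using unitary_one by blast
next
  case (Suc n N)
  let ?n = "Suc n"
  from spectrum_non_empty[OF Suc.prems(1)] obtain e where "eigenvalue N e"
    by (auto simp: spectrum_def)
  then obtain v where v: "v \<in> carrier_vec ?n" "v \<noteq> 0\<^sub>v ?n" "N *\<^sub>v v = e \<cdot>\<^sub>v v"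
    using Suc.prems(1) unfolding eigenvalue_def eigenvector_def by (metis carrier_matD(1))
  obtain U c where U: "unitary ?n U" and U0: "col U 0 = c \<cdot>\<^sub>v v"
    using unitary_extend_vec[OF v(1,2)] by blast
  note Uc = unitaryD[OF U]
  have U': "cadj U \<in> carrier_mat ?n ?n" and N': "cadj N \<in> carrier_mat ?n ?n"
    using Uc(1) Suc.prems(1) by simp_all
  note car = Uc(1) U' N' Suc.prems(1)
  define M where "M = cadj U * N * U"
  have M: "M \<in> carrier_mat ?n ?n" using car by (simp add: M_def)
  have cM: "cadj M = cadj U * cadj N * U"
    using car by (simp add: M_def cadj_mult[of _ ?n ?n _ ?n] assoc_mult_mat[of _ ?n ?n _ ?n _ ?n])
  have "M * cadj M = cadj U * (N * cadj N) * U"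
    unfolding cM unfolding M_def using car unitary_cancel[OF U, of _ ?n]
    by (simp add: assoc_mult_mat[of _ ?n ?n _ ?n _ ?n])
  also have "\<dots> = cadj M * M"
    unfolding cM Suc.prems(2) unfolding M_def using car unitary_cancel[OF U, of _ ?n]
    by (simp add: assoc_mult_mat[of _ ?n ?n _ ?n _ ?n])
  finally have nM: "M * cadj M = cadj M * M" .
  have "M = cadj U * (N * U)" using car by (simp add: M_def assoc_mult_mat[of _ ?n ?n _ ?n _ ?n])
  hence "col M 0 = cadj U *\<^sub>v col (N * U) 0"
    using col_mult2[OF U' mult_carrier_mat[OF Suc.prems(1) Uc(1)], of 0] by simp
  also have "col (N * U) 0 = N *\<^sub>v col U 0"
    using col_mult2[OF Suc.prems(1) Uc(1), of 0] by simp
  also have "N *\<^sub>v col U 0 = e \<cdot>\<^sub>v col U 0"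
    unfolding U0 using Suc.prems(1) v
    by (simp add: mult_mat_vec[of _ ?n ?n] smult_smult_assoc mult.commute)
  also have "cadj U *\<^sub>v (e \<cdot>\<^sub>v col U 0) = e \<cdot>\<^sub>v col (cadj U * U) 0"
    unfolding col_mult2[OF U' Uc(1) zero_less_Suc] by (intro mult_mat_vec[OF U'] col_carrier_vec[OF _ Uc(1)]) simp
  finally have "col M 0 = e \<cdot>\<^sub>v unit_vec ?n 0" using Uc(2) by simp
  hence colM: "col M 0 $ i = (e \<cdot>\<^sub>v unit_vec ?n 0) $ i" for i by simp
  have M0: "M $$ (i, 0) = (if i = 0 then e else 0)" if "i < ?n" for i
    using that carrier_matD[OF M] colM[of i] by simp
  have MM: "(M * cadj M) $$ (i, j) = (\<Sum>k<?n. M $$ (i, k) * cnj (M $$ (j, k)))"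
    "(cadj M * M) $$ (i, j) = (\<Sum>k<?n. cnj (M $$ (k, i)) * M $$ (k, j))" if "i < ?n" "j < ?n" for i j
    using that carrier_matD[OF M] by (simp_all add: mult_mat_index del: index_mult_mat(1) sum.lessThan_Suc)
  \<comment> \<open>For a normal matrix the 0-th row and the 0-th column have the same norm.\<close>
  have "(\<Sum>k<n. (cmod (M $$ (0, Suc k)))\<^sup>2) = 0"
  proof -
    have "(\<Sum>k<?n. M $$ (0, k) * cnj (M $$ (0, k))) = (\<Sum>k<?n. cnj (M $$ (k, 0)) * M $$ (k, 0))"
      using MM[of 0 0] nM by simp
    hence "(\<Sum>k<n. M $$ (0, Suc k) * cnj (M $$ (0, Suc k))) = 0"
      unfolding sum.lessThan_Suc_shift using M0 by simp
    hence "(\<Sum>k<n. complex_of_real ((cmod (M $$ (0, Suc k)))\<^sup>2)) = 0"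
      by (simp only: complex_norm_square)
    thus ?thesis unfolding of_real_sum[symmetric] of_real_eq_0_iff .
  qed
  hence M0': "M $$ (0, Suc k) = 0" if "k < n" for k
    using that by (subst (asm) sum_nonneg_eq_0_iff) auto
  define N1 where "N1 = mat n n (\<lambda>(i, j). M $$ (Suc i, Suc j))"
  have N1: "N1 \<in> carrier_mat n n" by (simp add: N1_def)
  \<comment> \<open>The cleared row and column add nothing to either product, so normality passes
    from \<open>M\<close> to its lower right block.\<close>
  have "N1 * cadj N1 = cadj N1 * N1"
  proof (rule eq_matI)
    fix i j assume "i < dim_row (cadj N1 * N1)" "j < dim_col (cadj N1 * N1)"
    hence ij: "i < n" "j < n" by (simp_all add: N1_def)
    have "(N1 * cadj N1) $$ (i, j) = (\<Sum>k<n. M $$ (Suc i, Suc k) * cnj (M $$ (Suc j, Suc k)))"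
      using ij by (subst mult_mat_index) (simp_all add: N1_def)
    also have "\<dots> = (M * cadj M) $$ (Suc i, Suc j)"
      using ij M0 by (subst MM(1)) (simp_all add: sum.lessThan_Suc_shift del: sum.lessThan_Suc)
    also have "\<dots> = (\<Sum>k<n. cnj (M $$ (Suc k, Suc i)) * M $$ (Suc k, Suc j))"
      unfolding nM using ij M0' by (subst MM(2)) (simp_all add: sum.lessThan_Suc_shift del: sum.lessThan_Suc)
    also have "\<dots> = (cadj N1 * N1) $$ (i, j)"
      using ij by (subst mult_mat_index) (simp_all add: N1_def)
    finally show "(N1 * cadj N1) $$ (i, j) = (cadj N1 * N1) $$ (i, j)" .
  qed (simp_all add: N1_def)
  then obtain V d where V: "unitary n V" and d: "cadj V * N1 * V = mat_diag n d"
    using Suc.IH[OF N1] by blast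
  let ?b = "\<lambda>A D. four_block_mat A (0\<^sub>m 1 n) (0\<^sub>m n 1) D"
  have Mb: "M = ?b (mat 1 1 (\<lambda>_. e)) N1"
  proof (rule eq_matI)
    fix i j assume "i < dim_row (?b (mat 1 1 (\<lambda>_. e)) N1)" "j < dim_col (?b (mat 1 1 (\<lambda>_. e)) N1)"
    hence "i < ?n" "j < ?n" by (simp_all add: N1_def)
    thus "M $$ (i, j) = ?b (mat 1 1 (\<lambda>_. e)) N1 $$ (i, j)"
      using M0[of i] M0'[of "j - 1"] by (cases i; cases j) (simp_all add: N1_def)
  qed (use M in \<open>simp_all add: N1_def\<close>)
  define W where "W = ?b (1\<^sub>m 1) V"
  have W: "unitary ?n W" using unitary_block_diag[OF unitary_one[of 1] V] by (simp add: W_def)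
  note Vc = unitaryD[OF V]
  have V': "cadj V \<in> carrier_mat n n" using Vc by simp
  have "cadj W = ?b (1\<^sub>m 1) (cadj V)"
    using carrier_matD[OF Vc(1)] unfolding W_def
    by (intro eq_matI) simp_all
  hence "cadj W * M * W = ?b (mat 1 1 (\<lambda>_. e)) (cadj V * N1 * V)"
    using Vc(1) V' N1 by (simp add: Mb W_def block_diag_mult)
  also have "\<dots> = mat_diag ?n (case_nat e d)"
    unfolding d by (intro eq_matI) (auto simp: mat_diag_def split: nat.splits)
  finally have "cadj W * M * W = mat_diag ?n (case_nat e d)" .
  moreover have "cadj (U * W) * N * (U * W) = cadj W * M * W"
    using car unitaryD(1)[OF W] unitaryD(1)[OF unitary_cadj[OF W]]
    by (simp add: M_def cadj_mult[of _ ?n ?n _ ?n] assoc_mult_mat[of _ ?n ?n _ ?n _ ?n])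
  ultimately show ?case using unitary_mult[OF U W] by metis
qed

section \<open>Standard and dual parts\<close>

lemma dual_sel_simps [simp]:
  "std_part (0 :: 'a::comm_ring_1 dual) = 0" "dual_part (0 :: 'a dual) = 0"
  "std_part (1 :: 'a dual) = 1" "dual_part (1 :: 'a dual) = 0"
  "std_part (x + y) = std_part x + std_part (y :: 'a dual)"
  "dual_part (x + y) = dual_part x + dual_part y"
  "std_part (x * y) = std_part x * std_part y"
  "dual_part (x * y) = std_part x * dual_part y + dual_part x * std_part y"
  "std_part (dc_of_dual z) = of_real (std_part z)" "dual_part (dc_of_dual z) = of_real (dual_part z)"
  by (simp_all add: zero_dual_def one_dual_def plus_dual_def times_dual_def dc_of_dual_def)

lemma dual_sel_conjugate [simp]:
  "std_part (conjugate x) = conjugate (std_part x)"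
  "dual_part (conjugate x) = conjugate (dual_part x)"
  for x :: "'a::{comm_ring_1,conjugatable_ring} dual"
  by (simp_all add: conjugate_dual_def)

lemma dual_sel_sum [simp]:
  "std_part (sum f A) = (\<Sum>x\<in>A. std_part (f x :: 'a::comm_ring_1 dual))"
  "dual_part (sum f A) = (\<Sum>x\<in>A. dual_part (f x))"
  by (induction A rule: infinite_finite_induct) simp_all

lemma dual_eq_iff: "x = y \<longleftrightarrow> std_part x = std_part y \<and> dual_part x = dual_part y"
  by (auto intro: dual.expand)

text \<open>Stands for X + eps Y, reducing dual matrices to pairs of matrices over the base
  ring.\<close>

definition dual_mat :: "'a mat \<Rightarrow> 'a mat \<Rightarrow> 'a dual mat" where
  "dual_mat X Y = mat (dim_row X) (dim_col X) (\<lambda>ij. Dual (X $$ ij) (Y $$ ij))"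

lemma dual_mat_dim [simp]:
  "dim_row (dual_mat X Y) = dim_row X" "dim_col (dual_mat X Y) = dim_col X"
  by (simp_all add: dual_mat_def)

lemma dual_mat_carrier [simp]: "X \<in> carrier_mat m n \<Longrightarrow> dual_mat X Y \<in> carrier_mat m n"
  by (simp add: dual_mat_def)

lemma dual_mat_mult:
  fixes X Y X' Y' :: "'a::comm_ring_1 mat"
  assumes "X \<in> carrier_mat m k" "Y \<in> carrier_mat m k" "X' \<in> carrier_mat k n" "Y' \<in> carrier_mat k n"
  shows "dual_mat X Y * dual_mat X' Y' = dual_mat (X * X') (X * Y' + Y * X')"
proof (rule eq_matI)
  note dims = carrier_matD[OF assms(1)] carrier_matD[OF assms(2)]
    carrier_matD[OF assms(3)] carrier_matD[OF assms(4)]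
  fix i j
  assume "i < dim_row (dual_mat (X * X') (X * Y' + Y * X'))"
    "j < dim_col (dual_mat (X * X') (X * Y' + Y * X'))"
  then show "(dual_mat X Y * dual_mat X' Y') $$ (i, j) = dual_mat (X * X') (X * Y' + Y * X') $$ (i, j)"
    by (simp add: dims mult_mat_index dual_mat_def dual_eq_iff sum.distrib del: index_mult_mat(1))
qed (use assms in simp_all)

lemma cadj_dual_mat:
  fixes X Y :: "'a::{comm_ring_1,conjugatable_ring} mat"
  assumes "X \<in> carrier_mat m n" "Y \<in> carrier_mat m n"
  shows "cadj (dual_mat X Y) = dual_mat (cadj X) (cadj Y)"
  using carrier_matD[OF assms(1)] carrier_matD[OF assms(2)]
  by (intro eq_matI) (simp_all add: dual_mat_def conjugate_dual_def)

lemma dual_mat_one: "dual_mat (1\<^sub>m n) (0\<^sub>m n n) = (1\<^sub>m n :: 'a::comm_ring_1 dual mat)"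
  by (intro eq_matI) (simp_all add: dual_mat_def dual_eq_iff)

lemma dual_mat_eta:
  assumes "A \<in> carrier_mat m n"
  shows "dual_mat (map_mat std_part A) (map_mat dual_part A) = A"
  using carrier_matD[OF assms] by (intro eq_matI) (simp_all add: dual_mat_def)

lemma unitary_dual_mat_zero:
  assumes "unitary n U"
  shows "unitary n (dual_mat U (0\<^sub>m n n))"
proof -
  note U = unitaryD[OF assms]
  have z: "cadj (0\<^sub>m n n :: 'a mat) = 0\<^sub>m n n" by (intro eq_matI) simp_all
  show ?thesis
    using U unfolding unitary_def
    by (simp add: cadj_dual_mat[of _ n n] z dual_mat_mult[of _ n n _ _ n] dual_mat_one)
qed

section \<open>Reordering eigenvalues by permuting the columns of a unitary matrix\<close>

lemma mult_mat_diag_cadj_index: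
  assumes "U \<in> carrier_mat m n" "i < m" "j < m"
  shows "(U * mat_diag n d * cadj U) $$ (i, j) =
    (\<Sum>k<n. U $$ (i, k) * d k * conjugate (U $$ (j, k) :: 'a::{comm_ring_1,conjugatable_ring}))"
  using assms(2,3) carrier_matD[OF assms(1)]
  by (subst mult_mat_index) (simp_all add: mat_diag_mult_right[OF assms(1)])

text \<open>The permutation relates the list of values to its sorted and reversed copy, which has
  the same multiset.\<close>

lemma ex_sorting_permutation:
  fixes f :: "nat \<Rightarrow> 'a::linorder"
  shows "\<exists>p. bij_betw p {..<n} {..<n} \<and> (\<forall>i j. i \<le> j \<and> j < n \<longrightarrow> f (p j) \<le> f (p i))"
proof -
  define xs where "xs = map f [0..<n]"
  have "mset (rev (sort xs)) = mset xs" by simp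
  then obtain p where p: "p permutes {..<length xs}" "permute_list p xs = rev (sort xs)"
    by (rule mset_eq_permutation)
  have len: "length xs = n" by (simp add: xs_def)
  have fp: "f (p i) = rev (sort xs) ! i" if "i < n" for i
  proof -
    have "p i < n" using permutes_in_image[OF p(1), of i] that by (simp add: len)
    thus ?thesis using that by (simp add: p(2)[symmetric] permute_list_nth[OF p(1)] len) (simp add: xs_def)
  qed
  \<comment> \<open>Reversal sends position \<open>i\<close> to \<open>n - Suc i\<close>, so the
    ascending list is read backwards.\<close>
  have "f (p j) \<le> f (p i)" if "i \<le> j" "j < n" for i j
    using that fp[of i] fp[of j] sorted_nth_mono[OF sorted_sort, of "n - Suc j" "n - Suc i" xs]
    by (simp add: rev_nth len)
  thus ?thesis using permutes_imp_bij[OF p(1)] len by auto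
qed

lemma unitary_permute_cols:
  fixes U :: "'a::{comm_ring_1,conjugatable_ring} mat"
  assumes U: "unitary n U" and p: "bij_betw p {..<n} {..<n}"
  defines "V \<equiv> mat n n (\<lambda>(i, j). U $$ (i, p j))"
  shows "unitary n V" "U * mat_diag n d * cadj U = V * mat_diag n (d \<circ> p) * cadj V"
proof -
  note Uc = unitaryD[OF U]
  have V: "V \<in> carrier_mat n n" by (simp add: V_def)
  have V_index: "V $$ (i, k) = U $$ (i, p k)" if "i < n" "k < n" for i k
    using that by (simp add: V_def)
  have eq: "U * mat_diag n e * cadj U = V * mat_diag n (e \<circ> p) * cadj V" for e
  proof (rule eq_matI)
    fix i j assume "i < dim_row (V * mat_diag n (e \<circ> p) * cadj V)" "j < dim_col (V * mat_diag n (e \<circ> p) * cadj V)"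
    hence ij: "i < n" "j < n" by (simp_all add: V_def)
    have "(\<Sum>k<n. U $$ (i, k) * e k * conjugate (U $$ (j, k)))
      = (\<Sum>k<n. U $$ (i, p k) * e (p k) * conjugate (U $$ (j, p k)))"
      by (rule sum.reindex_bij_betw[OF p, symmetric])
    thus "(U * mat_diag n e * cadj U) $$ (i, j) = (V * mat_diag n (e \<circ> p) * cadj V) $$ (i, j)"
      using ij by (simp add: mult_mat_diag_cadj_index[OF V] mult_mat_diag_cadj_index[OF Uc(1)] V_index
        del: index_mult_mat(1))
  qed (use Uc(1) in \<open>simp_all add: V_def\<close>)
  show "U * mat_diag n d * cadj U = V * mat_diag n (d \<circ> p) * cadj V" by (rule eq)
  \<comment> \<open>For the constant diagonal 1 the permutation identity reads
    \<open>U * cadj U = V * cadj V\<close>.\<close>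
  have "V * cadj V = 1\<^sub>m n"
    using eq[of "\<lambda>_. 1"] Uc V by (simp add: comp_def)
  thus "unitary n V"
    using mat_mult_left_right_inverse_comm_ring[of V n "cadj V"] V by (simp add: unitary_def)
qed

section \<open>Simultaneous diagonalisation of commuting Hermitian matrices\<close>

lemma mat_diag_real_dual_eq:
  "dual_mat (mat_diag n (\<lambda>i. of_real (Re (c i)))) (mat_diag n (\<lambda>i. of_real (Im (c i))))
    = dc_diag n (\<lambda>i. Dual (Re (c i)) (Im (c i)))"
  unfolding dc_diag_def
  by (intro eq_matI) (auto simp: dual_mat_def mat_diag_def dc_of_dual_def dual_eq_iff)

lemma commuting_hermitian_unitary_diag:
  fixes X Y :: "complex mat"
  assumes X: "X \<in> carrier_mat n n" "cadj X = X" and Y: "Y \<in> carrier_mat n n" "cadj Y = Y"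
    and comm: "X * Y = Y * X"
  shows "\<exists>U c. unitary n U \<and> cadj U * X * U = mat_diag n (\<lambda>i. of_real (Re (c i)))
    \<and> cadj U * Y * U = mat_diag n (\<lambda>i. of_real (Im (c i)))"
proof -
  \<comment> \<open>\<^term>\<open>X + \<i> \<cdot>\<^sub>m Y\<close> is normal, and its eigenvalues have those of \<^term>\<open>X\<close> and \<^term>\<open>Y\<close> as
    real and imaginary parts.\<close>
  define Z where "Z = \<i> \<cdot>\<^sub>m Y"
  have Z: "Z \<in> carrier_mat n n" using Y by (simp add: Z_def)
  have XZ: "X * Z = Z * X"
    using comm X Y by (simp add: Z_def mult_smult_distrib[of _ n n _ n] mult_smult_assoc_mat[of _ n n _ n])
  define N where "N = X + Z"
  have N: "N \<in> carrier_mat n n" using X Z by (simp add: N_def)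
  have herm: "cnj (X $$ (j, i)) = X $$ (i, j)" "cnj (Y $$ (j, i)) = Y $$ (i, j)" if "i < n" "j < n" for i j
    using that cadj_index[of i X j] cadj_index[of i Y j] X Y by simp_all
  have cN: "cadj N = X - Z"
    using herm carrier_matD[OF X(1)] carrier_matD[OF Y(1)]
    by (intro eq_matI) (simp_all add: N_def Z_def)
  have "N * cadj N = X * X - Z * Z + (Z * X - X * Z)"
    unfolding cN unfolding N_def using X(1) Z
    by (simp add: add_mult_distrib_mat[of _ n n _ _ n] mult_minus_distrib_mat[of _ n n _ n]) 
       (intro eq_matI; simp)
  moreover have "cadj N * N = X * X - Z * Z + (X * Z - Z * X)"
    unfolding cN unfolding N_def using X(1) Z
    by (simp add: mult_add_distrib_mat[of _ n n _ n] minus_mult_distrib_mat[of _ n n _ _ n]) 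
       (intro eq_matI; simp)
  ultimately have "N * cadj N = cadj N * N" using XZ by simp
  then obtain U c where U: "unitary n U" and c: "cadj U * N * U = mat_diag n c"
    using normal_mat_unitary_diag[OF N] by blast
  note Uc = unitaryD[OF U]
  have U': "cadj U \<in> carrier_mat n n" using Uc by simp
  define X1 Y1 where "X1 = cadj U * X * U" and "Y1 = cadj U * Y * U"
  have X1: "X1 \<in> carrier_mat n n" and Y1: "Y1 \<in> carrier_mat n n"
    using U' Uc X Y by (simp_all add: X1_def Y1_def)
  have cX1: "cadj X1 = X1" and cY1: "cadj Y1 = Y1"
    using U' Uc X Y
    by (simp_all add: X1_def Y1_def cadj_mult[of _ n n _ n] assoc_mult_mat[of _ n n _ n _ n])
  have "cadj U * N * U = X1 + \<i> \<cdot>\<^sub>m Y1"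
    using U' Uc X Y Z
    by (simp add: N_def Z_def X1_def Y1_def add_mult_distrib_mat[of _ n n _ _ n]
      mult_add_distrib_mat[of _ n n _ n] mult_smult_distrib[of _ n n _ n] mult_smult_assoc_mat[of _ n n _ n])
  hence ent0: "(X1 + \<i> \<cdot>\<^sub>m Y1) $$ (i, j) = mat_diag n c $$ (i, j)" for i j
    using c by simp
  have ent: "X1 $$ (i, j) + \<i> * Y1 $$ (i, j) = (if i = j then c j else 0)" if "i < n" "j < n" for i j
    using that X1 Y1 ent0[of i j] by (simp add: mat_diag_def)
  have herm1: "X1 $$ (j, i) = cnj (X1 $$ (i, j))" "Y1 $$ (j, i) = cnj (Y1 $$ (i, j))" if "i < n" "j < n" for i j
    using that cadj_index[of j X1 i] cadj_index[of j Y1 i] cX1 cY1 X1 Y1 by simp_all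
  \<comment> \<open>Off the diagonal the sum vanishes at \<open>(i, j)\<close> and at
    \<open>(j, i)\<close>; conjugating the second equation flips the sign of the imaginary unit, so
    both entries are 0. On the diagonal both entries are real.\<close>
  have sol: "X1 $$ (i, j) = (if i = j then of_real (Re (c j)) else 0)
    \<and> Y1 $$ (i, j) = (if i = j then of_real (Im (c j)) else 0)" if ij: "i < n" "j < n" for i j
    using ent[OF ij] ent[OF ij(2,1)] herm1[OF ij]
    by (auto simp: complex_eq_iff split: if_splits)
  show ?thesis
    using U sol X1 Y1 unfolding X1_def[symmetric] Y1_def[symmetric]
    by (intro exI[of _ U] exI[of _ c] conjI eq_matI) (simp_all add: X1_def[symmetric] Y1_def[symmetric] mat_diag_def)
qed

section \<open>Spectral theorem for dual Hermitian matrices\<close>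

text \<open>Three conjugations: \<open>U1\<close> diagonalises the standard part, \<open>U2\<close>
  removes the dual entries between different eigenvalues, \<open>U4\<close> diagonalises both parts
  at once. A column permutation then sorts the eigenvalues.\<close>

theorem dual_hermitian_spectral:
  fixes H :: "complex dual mat"
  assumes H: "H \<in> carrier_mat n n" "cadj H = H"
  shows "\<exists>U l. unitary n U \<and> (\<forall>i j. i \<le> j \<and> j < n \<longrightarrow> l j \<le> l i)
    \<and> H = U * dc_diag n l * cadj U"
proof -
  define A B where "A = map_mat std_part H" and "B = map_mat dual_part H"
  have A: "A \<in> carrier_mat n n" and B: "B \<in> carrier_mat n n" using H(1) by (simp_all add: A_def B_def)
  have H_AB: "H = dual_mat A B" using dual_mat_eta[OF H(1)] by (simp add: A_def B_def)
  have ent: "conjugate (H $$ (j, i)) = H $$ (i, j)" if "i < n" "j < n" for i j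
    using cadj_index[of i H j] that H by simp
  have ent_parts: "cnj (std_part (H $$ (j, i))) = std_part (H $$ (i, j))"
    "cnj (dual_part (H $$ (j, i))) = dual_part (H $$ (i, j))" if "i < n" "j < n" for i j
    using arg_cong[OF ent[OF that], of std_part] arg_cong[OF ent[OF that], of dual_part] by simp_all
  have cA: "cadj A = A"
    using ent_parts carrier_matD[OF H(1)] by (intro eq_matI) (simp_all add: A_def)
  have cB: "cadj B = B"
    using ent_parts carrier_matD[OF H(1)] by (intro eq_matI) (simp_all add: B_def)
  \<comment> \<open>Applied to the pair \<open>A\<close>, \<open>A\<close>, this is the spectral
    theorem for the single Hermitian matrix \<open>A\<close>, with real eigenvalues.\<close>
  obtain U0 c0 where U0: "unitary n U0"
    and A_diag: "cadj U0 * A * U0 = mat_diag n (\<lambda>i. of_real (Re (c0 i)))"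
    using commuting_hermitian_unitary_diag[OF A cA A cA refl] by blast
  define a where "a i = Re (c0 i)" for i
  note U0c = unitaryD[OF U0]
  have U0': "cadj U0 \<in> carrier_mat n n" using U0c by simp
  define D where "D = mat_diag n (\<lambda>i. complex_of_real (a i))"
  have D: "D \<in> carrier_mat n n" "cadj D = D" by (simp_all add: D_def cadj_mat_diag)
  define B1 where "B1 = cadj U0 * B * U0"
  have B1: "B1 \<in> carrier_mat n n" using U0c U0' B by (simp add: B1_def)
  have cB1: "cadj B1 = B1"
    unfolding B1_def using U0c U0' B cB by (simp add: cadj_mult[of _ n n _ n] assoc_mult_mat[of _ n n _ n _ n])
  have B1_herm: "cnj (B1 $$ (j, i)) = B1 $$ (i, j)" if "i < n" "j < n" for i j
    using cadj_index[of i B1 j] that B1 cB1 by simp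
  define U1 where "U1 = dual_mat U0 (0\<^sub>m n n)"
  have U1: "unitary n U1" unfolding U1_def by (rule unitary_dual_mat_zero[OF U0])
  have z: "cadj (0\<^sub>m n n :: complex mat) = 0\<^sub>m n n" by (intro eq_matI) simp_all
  have conj0: "cadj (dual_mat W (0\<^sub>m n n)) * dual_mat X Y * dual_mat W (0\<^sub>m n n)
      = dual_mat (cadj W * X * W) (cadj W * Y * W)"
    if "W \<in> carrier_mat n n" "X \<in> carrier_mat n n" "Y \<in> carrier_mat n n" for W X Y :: "complex mat"
    using that by (simp add: cadj_dual_mat[of _ n n] z dual_mat_mult[of _ n n _ _ n])
  have H1: "cadj U1 * H * U1 = dual_mat D B1"
    using conj0[OF U0c(1) A B] by (simp add: U1_def H_AB A_diag D_def a_def B1_def)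
  \<comment> \<open>Conjugation by 1 + eps Q adds D Q - Q D to the dual part; this \<^term>\<open>Q\<close> makes all entries
    between different eigenvalues vanish, so that the new dual part commutes with \<^term>\<open>D\<close>.\<close>
  define Q where "Q = mat n n (\<lambda>(i, j). if a i = a j then 0 else - B1 $$ (i, j) / of_real (a i - a j))"
  have Q: "Q \<in> carrier_mat n n" by (simp add: Q_def)
  have cQ: "cadj Q \<in> carrier_mat n n" using Q by simp
  have skew: "cadj Q $$ (i, j) = - Q $$ (i, j)" if "i < n" "j < n" for i j
    using that B1_herm[of i j] by (auto simp: Q_def field_simps)
  define U2 where "U2 = dual_mat (1\<^sub>m n) Q"
  have cU2: "cadj U2 = dual_mat (1\<^sub>m n) (cadj Q)"
    unfolding U2_def using Q by (simp add: cadj_dual_mat[of _ n n])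
  \<comment> \<open>Because eps squared is 0, 1 + eps Q is unitary exactly when \<open>Q\<close> is
    skew-Hermitian.\<close>
  have "Q + cadj Q = 0\<^sub>m n n" using skew Q by (intro eq_matI) simp_all
  hence U2: "unitary n U2"
    using Q unfolding unitary_def cU2 unfolding U2_def
    by (simp add: dual_mat_mult[of _ n n _ _ n] dual_mat_one)
  define B2 where "B2 = D * Q + B1 + cadj Q * D"
  have B2: "B2 \<in> carrier_mat n n" using B1 Q D by (simp add: B2_def)
  have H2: "cadj U2 * dual_mat D B1 * U2 = dual_mat D B2"
    unfolding cU2 unfolding U2_def using Q D B1
    by (simp add: dual_mat_mult[of _ n n _ _ n] B2_def assoc_add_mat[of _ n n])
  have B2_index: "B2 $$ (i, j) = (if a i = a j then B1 $$ (i, j) else 0)" if "i < n" "j < n" for i j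
    using that Q B1 cQ skew[of i j] unfolding B2_def D_def
    by (simp add: mat_diag_mult_left[of _ n n] mat_diag_mult_right[of _ n n])
      (simp add: Q_def field_simps)
  have "cadj B2 = B2"
    using B2_index B1_herm carrier_matD[OF B2] by (intro eq_matI) simp_all
  moreover have "D * B2 = B2 * D"
    using B2_index B2 unfolding D_def
    by (intro eq_matI) (simp_all add: mat_diag_mult_left[of _ n n] mat_diag_mult_right[of _ n n])
  ultimately obtain U3 c where U3: "unitary n U3"
    and c: "cadj U3 * D * U3 = mat_diag n (\<lambda>i. of_real (Re (c i)))"
      "cadj U3 * B2 * U3 = mat_diag n (\<lambda>i. of_real (Im (c i)))"
    using commuting_hermitian_unitary_diag[OF D B2] by blast
  note U3c = unitaryD[OF U3]
  define U4 where "U4 = dual_mat U3 (0\<^sub>m n n)"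
  have U4: "unitary n U4" unfolding U4_def by (rule unitary_dual_mat_zero[OF U3])
  \<comment> \<open>The complex number \<open>c i\<close> holds eigenvalues of \<open>D\<close> and
    of \<open>B2\<close> for a common eigenvector; it is reread as a dual number.\<close>
  define l where "l i = Dual (Re (c i)) (Im (c i))" for i
  have H3: "cadj U4 * dual_mat D B2 * U4 = dc_diag n l"
    using conj0[OF U3c(1) D(1) B2] by (simp add: U4_def c mat_diag_real_dual_eq l_def[abs_def])
  define U where "U = U1 * (U2 * U4)"
  have U: "unitary n U" unfolding U_def by (intro unitary_mult U1 U2 U4)
  have car: "U1 \<in> carrier_mat n n" "U2 \<in> carrier_mat n n" "U4 \<in> carrier_mat n n"
    "cadj U1 \<in> carrier_mat n n" "cadj U2 \<in> carrier_mat n n" "cadj U4 \<in> carrier_mat n n"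
    using U1 U2 U4 by (simp_all add: unitary_def)
  have "cadj U * H * U = cadj U4 * (cadj U2 * (cadj U1 * H * U1) * U2) * U4"
    unfolding U_def using car H(1)
    by (simp add: cadj_mult[of _ n n _ n] assoc_mult_mat[of _ n n _ n _ n])
  hence "cadj U * H * U = dc_diag n l" by (simp only: H1 H2 H3)
  hence HU: "H = U * dc_diag n l * cadj U"
    using unitary_conj_diag_iff[OF U H(1), of "dc_diag n l"] by (simp add: dc_diag_def)
  obtain p where p: "bij_betw p {..<n} {..<n}"
    and sorted: "\<forall>i j. i \<le> j \<and> j < n \<longrightarrow> (l \<circ> p) j \<le> (l \<circ> p) i"
    using ex_sorting_permutation[of n l] by auto
  show ?thesis
    using unitary_permute_cols[OF U p] sorted HU unfolding dc_diag_def
    by (intro exI[of _ "mat n n (\<lambda>(i, j). U $$ (i, p j))"] exI[of _ "l \<circ> p"])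
      (simp add: comp_def)
qed

section \<open>Traces, used to count eigenvalues and singular values\<close>

definition mat_trace :: "'a::comm_ring_1 mat \<Rightarrow> 'a" where
  "mat_trace A = (\<Sum>i<dim_row A. A $$ (i, i))"

lemma mat_trace_comm:
  assumes "A \<in> carrier_mat m n" "B \<in> carrier_mat n m"
  shows "mat_trace (A * B) = mat_trace (B * A)"
proof -
  have "mat_trace (A * B) = (\<Sum>i<m. \<Sum>k<n. A $$ (i, k) * B $$ (k, i))"
    using carrier_matD[OF assms(1)] carrier_matD[OF assms(2)]
    by (simp add: mat_trace_def mult_mat_index del: index_mult_mat(1))
  also have "\<dots> = (\<Sum>k<n. \<Sum>i<m. B $$ (k, i) * A $$ (i, k))"
    by (subst sum.swap) (simp add: mult.commute)
  also have "\<dots> = mat_trace (B * A)"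
    using carrier_matD[OF assms(1)] carrier_matD[OF assms(2)]
    by (simp add: mat_trace_def mult_mat_index del: index_mult_mat(1))
  finally show ?thesis .
qed

lemma mat_trace_one: "mat_trace (1\<^sub>m n) = of_nat n"
  by (simp add: mat_trace_def)

lemma mat_trace_unitary_conj:
  assumes U: "unitary n U" and N: "N \<in> carrier_mat n n"
  shows "mat_trace (U * N * cadj U) = mat_trace N"
proof -
  note Uc = unitaryD[OF U]
  have U': "cadj U \<in> carrier_mat n n" using Uc by simp
  have "mat_trace (U * N * cadj U) = mat_trace (cadj U * (U * N))"
    using Uc(1) U' N by (intro mat_trace_comm[of _ n n]) simp_all
  thus ?thesis using unitary_cancel(1)[OF U N] by simp
qed

lemma of_nat_dual_inject: "(of_nat a :: complex dual) = of_nat b \<longleftrightarrow> a = b"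
proof -
  have "std_part (of_nat k :: complex dual) = of_nat k" for k by (induction k) simp_all
  thus ?thesis by (metis of_nat_eq_iff)
qed

text \<open>Provides the cut-off index in a nonincreasing sequence of eigenvalues: after the
  eigenvalues 1 of a projection, and after those with positive standard part.\<close>

lemma ex_threshold:
  assumes "\<And>i j. i \<le> j \<Longrightarrow> j < n \<Longrightarrow> P j \<Longrightarrow> P i"
  shows "\<exists>s\<le>(n::nat). \<forall>i<n. P i \<longleftrightarrow> i < s"
  using assms
proof (induction n)
  case (Suc n)
  then obtain s where s: "s \<le> n" "\<forall>i<n. P i \<longleftrightarrow> i < s" by (metis less_Suc_eq)
  show ?case
  proof (cases "P n")
    case True
    thus ?thesis using Suc.prems[of _ n] by (intro exI[of _ "Suc n"]) auto
  next
    case False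
    thus ?thesis using s by (intro exI[of _ s]) (auto simp: less_Suc_eq)
  qed
qed simp

section \<open>Extension to unitary matrices\<close>

lemma dc_of_dual_simps [simp]:
  "dc_of_dual (x * y) = dc_of_dual x * dc_of_dual y"
  "dc_of_dual 0 = 0" "dc_of_dual 1 = 1"
  "conjugate (dc_of_dual x) = dc_of_dual x"
  "dc_of_dual x = dc_of_dual y \<longleftrightarrow> x = y"
  by (auto simp: dual_eq_iff)

lemma dc_diag_carrier: "dc_diag n l \<in> carrier_mat n n"
  by (simp add: dc_diag_def)

lemma dc_diag_index [simp]:
  "i < n \<Longrightarrow> j < n \<Longrightarrow> dc_diag n l $$ (i, j) = (if i = j then dc_of_dual (l j) else 0)"
  by (simp add: dc_diag_def mat_diag_def)

text \<open>The standard part s is 0 or 1, and the dual part d satisfies 2 s d = d, which forces d =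
  0 in both cases.\<close>

lemma dual_idempotent_cases:
  fixes x :: "real dual"
  assumes "x * x = x"
  shows "x = 0 \<or> x = 1"
proof -
  have a: "std_part x * std_part x = std_part x"
    and b: "2 * std_part x * dual_part x = dual_part x"
    using assms by (simp_all add: dual_eq_iff algebra_simps)
  from a have "std_part x = 0 \<or> std_part x = 1" by simp
  with b show ?thesis by (auto simp: dual_eq_iff)
qed

lemma dual_zero_less_one: "(0 :: real dual) < 1"
  by (simp add: less_dual_def less_eq_dual_def)

text \<open>The orthogonal projection \<^term>\<open>cadj Q * Q\<close> onto the row space of \<^term>\<open>Q\<close> has eigenvalues 0 and 1 only, and its trace
  counts the latter, so its eigenvectors for 0 are exactly the missing columns.\<close>

lemma coisometry_extend_unitary:
  fixes Q :: "complex dual mat"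
  assumes Q: "Q \<in> carrier_mat r n" "Q * cadj Q = 1\<^sub>m r"
  shows "\<exists>V. unitary n V \<and> (\<forall>i<r. \<forall>j<n. cadj V $$ (i, j) = Q $$ (i, j))"
proof -
  have Q': "cadj Q \<in> carrier_mat n r" using Q by simp
  define H where "H = cadj Q * Q"
  have H: "H \<in> carrier_mat n n" using Q Q' by (simp add: H_def)
  have QH: "Q * H = Q"
    unfolding H_def using assoc_mult_mat[OF Q(1) Q' Q(1)] Q by simp
  have HH: "H * H = H"
    using assoc_mult_mat[OF Q' Q(1) H] QH by (simp add: H_def)
  have "cadj H = H" unfolding H_def using Q Q' by (simp add: cadj_mult[of _ n r _ n])
  then obtain W l where W: "unitary n W"
    and sorted: "\<forall>i j. i \<le> j \<and> j < n \<longrightarrow> l j \<le> l i"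
    and HW: "H = W * dc_diag n l * cadj W"
    using dual_hermitian_spectral[OF H] by blast
  note Wc = unitaryD[OF W]
  have W': "cadj W \<in> carrier_mat n n" using Wc by simp
  have Dc: "dc_diag n l \<in> carrier_mat n n" by (rule dc_diag_carrier)
  have WD: "H * W = W * dc_diag n l"
    unfolding HW using Wc W' Dc by (simp add: assoc_mult_mat[of _ n n _ n _ n])
  have D_eq: "dc_diag n l = cadj W * H * W"
    using iffD1[OF unitary_conj_diag_iff[OF W H Dc] HW] by (rule sym)
  have "dc_diag n l * dc_diag n l = cadj W * (H * H) * W"
    unfolding D_eq using H Wc W' unitary_cancel[OF W, of _ n] by (simp add: assoc_mult_mat[of _ n n _ n _ n])
  hence DD: "dc_diag n l * dc_diag n l = dc_diag n l" by (simp only: HH D_eq)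
  have l01: "l i = 0 \<or> l i = 1" if "i < n" for i
  proof -
    have "(dc_diag n l * dc_diag n l) $$ (i, i) = dc_of_dual (l i * l i)"
      unfolding dc_diag_def mat_diag_diag using that by (simp add: mat_diag_def)
    hence "dc_of_dual (l i * l i) = dc_of_dual (l i)" unfolding DD using that by simp
    hence "l i * l i = l i" unfolding dc_of_dual_simps(5) .
    thus ?thesis by (rule dual_idempotent_cases)
  qed
  \<comment> \<open>The eigenvalues are nonincreasing and 0 < 1, so the ones come first.\<close>
  have "l i = 1" if "i \<le> j" "j < n" "l j = 1" for i j
    using l01[of i] sorted that dual_zero_less_one by (metis le_less_trans not_le)
  then obtain s where s: "s \<le> n" and ls: "\<forall>i<n. l i = 1 \<longleftrightarrow> i < s"
    using ex_threshold[of n "\<lambda>i. l i = 1"] by blast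
  have l0: "l i = 0" if "i < n" "\<not> i < s" for i using that l01[of i] ls by auto
  \<comment> \<open>Cyclicity of the trace equates the number \<open>r\<close> of rows of
    \<open>Q\<close> with the number \<open>s\<close> of eigenvalues 1.\<close>
  have "of_nat r = mat_trace (Q * cadj Q)" by (simp add: Q mat_trace_one)
  also have "\<dots> = mat_trace H" unfolding H_def by (rule mat_trace_comm[OF Q(1) Q'])
  also have "\<dots> = mat_trace (dc_diag n l)" unfolding HW by (rule mat_trace_unitary_conj[OF W Dc])
  also have "\<dots> = (\<Sum>i<n. if i < s then 1 else 0)"
    unfolding mat_trace_def using ls l0
    by (intro sum.cong) (auto simp: dc_diag_def mat_diag_def)
  also have "\<dots> = of_nat (card {i \<in> {..<n}. i < s})" by (simp add: sum.If_cases Int_def)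
  also have "{i \<in> {..<n}. i < s} = {..<s}" using s by auto
  finally have rs: "r = s" by (simp add: of_nat_dual_inject)
  define V where "V = mat n n (\<lambda>(i, j). if j < r then conjugate (Q $$ (j, i)) else W $$ (i, j))"
  have QW: "(\<Sum>k<n. Q $$ (i, k) * W $$ (k, j)) = 0" if "i < r" "r \<le> j" "j < n" for i j
  proof -
    have "l j = 0" using l01[of j] ls that rs by auto
    hence HW0: "(H * W) $$ (k, j) = 0" if "k < n" for k
      unfolding WD dc_diag_def mat_diag_mult_right[OF Wc(1)] using that \<open>j < n\<close> by simp
    \<comment> \<open>As \<open>Q = Q * H\<close>, the eigenvectors of \<open>H\<close> for 0 are
      annihilated by \<open>Q\<close>.\<close>
    have "Q * W = Q * (H * W)"
      using QH assoc_mult_mat[OF Q(1) H Wc(1)] by simp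
    hence "(Q * W) $$ (i, j) = (Q * (H * W)) $$ (i, j)" by simp
    also have "\<dots> = (\<Sum>k<n. Q $$ (i, k) * (H * W) $$ (k, j))"
      using that carrier_matD[OF Q(1)] carrier_matD[OF Wc(1)] carrier_matD[OF H]
      by (subst mult_mat_index) simp_all
    also have "\<dots> = 0" using HW0 by (intro sum.neutral) simp
    finally show ?thesis
      using that carrier_matD[OF Q(1)] carrier_matD[OF Wc(1)]
      by (subst (asm) mult_mat_index) simp_all
  qed
  have QQ: "(\<Sum>k<n. Q $$ (i, k) * conjugate (Q $$ (j, k))) = (if i = j then 1 else 0)"
    if "i < r" "j < r" for i j
    using that Q carrier_matD[OF Q(1)] mult_mat_index[of i Q j "cadj Q"] by simp
  have WW: "(\<Sum>k<n. conjugate (W $$ (k, i)) * W $$ (k, j)) = (if i = j then 1 else 0)"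
    if "i < n" "j < n" for i j
    using that Wc(2) carrier_matD[OF Wc(1)] mult_mat_index[of i "cadj W" j W] by simp
  have "cadj V * V = 1\<^sub>m n"
  proof (rule eq_matI)
    fix i j assume "i < dim_row (1\<^sub>m n)" "j < dim_col (1\<^sub>m n)"
    hence ij: "i < n" "j < n" by auto
    have e: "(cadj V * V) $$ (i, j) = (\<Sum>k<n. conjugate (V $$ (k, i)) * V $$ (k, j))"
      using ij by (subst mult_mat_index) (simp_all add: V_def)
    have V_index: "V $$ (k, m) = (if m < r then conjugate (Q $$ (m, k)) else W $$ (k, m))"
      if "k < n" "m < n" for k m using that by (simp add: V_def)
    consider "i < r" "j < r" | "i < r" "r \<le> j" | "r \<le> i" "j < r" | "r \<le> i" "r \<le> j" by linarith
    thus "(cadj V * V) $$ (i, j) = 1\<^sub>m n $$ (i, j)"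
    proof cases
      case 1
      thus ?thesis using ij QQ[of i j] unfolding e by (simp add: V_index)
    next
      case 2
      thus ?thesis using ij QW[of i j] unfolding e by (simp add: V_index)
    next
      case 3
      have "(\<Sum>k<n. conjugate (W $$ (k, i)) * conjugate (Q $$ (j, k)))
          = conjugate (\<Sum>k<n. Q $$ (j, k) * W $$ (k, i))"
        by (simp add: sum_conjugate conjugate_dist_mul mult.commute)
      thus ?thesis using 3 ij QW[of j i] unfolding e by (simp add: V_index)
    next
      case 4
      thus ?thesis using ij WW[of i j] unfolding e by (simp add: V_index)
    qed
  qed (simp_all add: V_def)
  hence "unitary n V" by (simp add: unitary_def V_def)
  moreover have "cadj V $$ (i, j) = Q $$ (i, j)" if "i < r" "j < n" for i j
    using that rs s by (simp add: V_def)
  ultimately show ?thesis by blast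
qed

text \<open>Each column of \<open>A\<close> lies in the range of \<open>A * A\<close>; chosen
  preimages of the columns form \<open>X\<close>.\<close>

lemma dc_CM_factor:
  assumes "A \<in> dc_CM n"
  shows "A \<in> carrier_mat n n" "\<exists>X. X \<in> carrier_mat n n \<and> A = A * A * X"
proof -
  show A: "A \<in> carrier_mat n n" using assms by (simp add: dc_CM_def)
  have AA: "A ^\<^sub>m 2 = A * A" using A by (simp add: numeral_2_eq_2)
  have "\<forall>j. \<exists>x. x \<in> carrier_vec n \<and> A *\<^sub>v unit_vec n j = (A * A) *\<^sub>v x"
  proof
    fix j
    have "A *\<^sub>v unit_vec n j \<in> mat_range A"
      unfolding mat_range_def using A by auto
    hence "A *\<^sub>v unit_vec n j \<in> mat_range (A * A)" using assms AA by (simp add: dc_CM_def)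
    thus "\<exists>x. x \<in> carrier_vec n \<and> A *\<^sub>v unit_vec n j = (A * A) *\<^sub>v x"
      using A unfolding mat_range_def by auto
  qed
  then obtain x where x: "\<And>j. x j \<in> carrier_vec n" "\<And>j. A *\<^sub>v unit_vec n j = (A * A) *\<^sub>v x j"
    by metis
  define X where "X = mat n n (\<lambda>(i, j). x j $ i)"
  have "A = A * A * X"
  proof (rule eq_matI)
    fix i j assume "i < dim_row (A * A * X)" "j < dim_col (A * A * X)"
    hence ij: "i < n" "j < n" using A by (simp_all add: X_def)
    have "col X j = x j" using ij carrier_vecD[OF x(1)[of j]] by (intro eq_vecI) (simp_all add: X_def)
    hence "(A * A * X) $$ (i, j) = ((A * A) *\<^sub>v x j) $ i" using ij A by (simp add: X_def)
    also have "\<dots> = (A *\<^sub>v unit_vec n j) $ i" by (simp only: x)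
    also have "\<dots> = A $$ (i, j)" using ij A by simp
    finally show "A $$ (i, j) = (A * A * X) $$ (i, j)" by simp
  qed (use A in \<open>simp_all add: X_def\<close>)
  thus "\<exists>X. X \<in> carrier_mat n n \<and> A = A * A * X" by (intro exI[of _ X]) (simp add: X_def)
qed

section \<open>From a singular value decomposition to the group inverse\<close>

text \<open>First-order expansion of the reciprocal: 1/(a + eps b) = 1/a - eps b/a^2.\<close>

lemma complex_dual_unit:
  fixes x :: "complex dual"
  assumes "std_part x \<noteq> 0"
  shows "\<exists>y. x * y = 1"
  using assms
  by (intro exI[of _ "Dual (1 / std_part x) (- dual_part x / (std_part x * std_part x))"])
    (simp add: dual_eq_iff)

text \<open>Taking standard parts is a ring homomorphism; thus a unit determinant can be recognised
  on standard parts.\<close>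

lemma std_part_det:
  fixes A :: "'a::comm_ring_1 dual mat"
  shows "std_part (det A) = det (map_mat std_part A)"
proof -
  interpret comm_ring_hom "std_part :: 'a dual \<Rightarrow> 'a"
    by unfold_locales simp_all
  show ?thesis by (rule hom_det[symmetric])
qed

lemma four_block_mat_split:
  assumes "W \<in> carrier_mat (r + p) (c + q)"
  shows "W = four_block_mat (mat r c (\<lambda>(i, j). W $$ (i, j))) (mat r q (\<lambda>(i, j). W $$ (i, j + c)))
    (mat p c (\<lambda>(i, j). W $$ (i + r, j))) (mat p q (\<lambda>(i, j). W $$ (i + r, j + c)))"
  using carrier_matD[OF assms] by (intro eq_matI) simp_all

lemma four_block_mat_top_inject:
  assumes "A \<in> carrier_mat r c" "A' \<in> carrier_mat r c" "D \<in> carrier_mat p q" "D' \<in> carrier_mat p q"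
    and eq: "four_block_mat A B C D = four_block_mat A' B' C' D'"
  shows "A = A'"
proof (rule eq_matI)
  fix i j assume "i < dim_row A'" "j < dim_col A'"
  thus "A $$ (i, j) = A' $$ (i, j)"
    using arg_cong[OF eq, of "\<lambda>M. M $$ (i, j)"] carrier_matD[OF assms(1)] carrier_matD[OF assms(2)]
      carrier_matD[OF assms(3)] carrier_matD[OF assms(4)]
    by simp
qed (use assms in simp_all)

text \<open>An appreciable \<open>\<mu> i\<close> cancels in the standard parts. If instead
  \<open>\<mu> i\<close> is eps d with d nonzero, then d cancels in the dual parts, which see only
  the standard part of \<open>G\<close>.\<close>

lemma dc_diag_fixed_std:
  assumes pos: "\<And>i. i < t \<Longrightarrow> 0 < \<mu> i" and G: "G \<in> carrier_mat t t"
    and eq: "dc_diag t \<mu> * G = dc_diag t \<mu>"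
  shows "map_mat std_part G = 1\<^sub>m t"
proof (rule eq_matI)
  fix i j assume "i < dim_row (1\<^sub>m t)" "j < dim_col (1\<^sub>m t)"
  hence ij: "i < t" "j < t" by auto
  have "(dc_diag t \<mu> * G) $$ (i, j) = dc_of_dual (\<mu> i) * G $$ (i, j)"
    unfolding dc_diag_def mat_diag_mult_left[OF G] using ij by simp
  hence *: "dc_of_dual (\<mu> i) * G $$ (i, j) = (if i = j then dc_of_dual (\<mu> i) else 0)"
    unfolding eq using ij by (cases "i = j") simp_all
  have "std_part (\<mu> i) \<noteq> 0 \<or> std_part (\<mu> i) = 0 \<and> dual_part (\<mu> i) \<noteq> 0"
    using pos[OF ij(1)] by (auto simp: less_dual_def less_eq_dual_def)
  hence "std_part (G $$ (i, j)) = (if i = j then 1 else 0)"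
    using * by (auto simp: dual_eq_iff split: if_splits)
  thus "map_mat std_part G $$ (i, j) = 1\<^sub>m t $$ (i, j)" using ij G by simp
qed (use G in simp_all)

text \<open>The decomposition is arbitrary, so the results apply to every dual SVD of
  \<open>A\<close>; the uniqueness of the rank relies on this.\<close>

locale CM_svd =
  fixes A P V :: "complex dual mat" and n t :: nat and \<mu> :: "nat \<Rightarrow> real dual"
  assumes CM: "A \<in> dc_CM n" and svd: "is_dual_svd A P t \<mu> V"
begin

abbreviation "S \<equiv> dc_diag t \<mu>"
abbreviation "bl B C \<equiv> four_block_mat B C (0\<^sub>m (n - t) t) (0\<^sub>m (n - t) (n - t))"

text \<open>Coordinates of the columns of \<open>P\<close> in the basis formed by the columns of
  \<open>V\<close>.\<close>

definition "W = cadj V * P"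
definition "K = mat t t (\<lambda>(i, j). W $$ (i, j))"
definition "L = mat t (n - t) (\<lambda>(i, j). W $$ (i, j + t))"

lemma svd_unfold:
  "A \<in> carrier_mat n n" "unitary n P" "unitary n V" "t \<le> n"
  "\<And>i. i < t \<Longrightarrow> 0 < \<mu> i" "\<And>i j. i \<le> j \<Longrightarrow> j < t \<Longrightarrow> \<mu> j \<le> \<mu> i"
  "A = P * bl S (0\<^sub>m t (n - t)) * cadj V"
proof -
  show A: "A \<in> carrier_mat n n" using dc_CM_factor(1)[OF CM] .
  show "unitary n P" "unitary n V" "t \<le> n"
  "\<And>i. i < t \<Longrightarrow> 0 < \<mu> i" "\<And>i j. i \<le> j \<Longrightarrow> j < t \<Longrightarrow> \<mu> j \<le> \<mu> i"
  "A = P * bl S (0\<^sub>m t (n - t)) * cadj V"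
    using svd A unfolding is_dual_svd_def Let_def dc_unitary_iff adj_eq_cadj by auto
qed

lemma carriers:
  "P \<in> carrier_mat n n" "cadj P \<in> carrier_mat n n" "V \<in> carrier_mat n n" "cadj V \<in> carrier_mat n n"
  "W \<in> carrier_mat n n" "K \<in> carrier_mat t t" "L \<in> carrier_mat t (n - t)" "S \<in> carrier_mat t t"
  using svd_unfold(2,3) by (simp_all add: unitary_def W_def K_def L_def dc_diag_carrier mult_carrier_mat[of _ n n _ n])

lemma bl_carrier: "B \<in> carrier_mat t t \<Longrightarrow> bl B C \<in> carrier_mat n n"
  using svd_unfold(4) four_block_carrier_mat[of B t t "0\<^sub>m (n - t) (n - t)" "n - t" "n - t"] by simp

lemma bl_mult:
  assumes "B \<in> carrier_mat t t" "C \<in> carrier_mat t (n - t)"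
    "B' \<in> carrier_mat t t" "C' \<in> carrier_mat t (n - t)"
    "(M' :: complex dual mat) \<in> carrier_mat (n - t) t" "N' \<in> carrier_mat (n - t) (n - t)"
  shows "bl B C * four_block_mat B' C' M' N' = bl (B * B' + C * M') (B * C' + C * N')"
  using assms by (subst mult_four_block_mat[of _ t t _ "n - t" _ "n - t" _ _ t _ "n - t"]) simp_all

text \<open>The block \<open>C\<close> only meets the zero rows of the right factor and drops
  out.\<close>

lemma bl_mult_bl:
  assumes "B \<in> carrier_mat t t" "C \<in> carrier_mat t (n - t)"
    "B' \<in> carrier_mat t t" "(C' :: complex dual mat) \<in> carrier_mat t (n - t)"
  shows "bl B C * bl B' C' = bl (B * B') (B * C')"
  using assms by (subst bl_mult) simp_all

lemma W_split:
  obtains M N where "M \<in> carrier_mat (n - t) t" "N \<in> carrier_mat (n - t) (n - t)"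
    "W = four_block_mat K L M N"
proof -
  let ?M = "mat (n - t) t (\<lambda>(i, j). W $$ (i + t, j))"
  let ?N = "mat (n - t) (n - t) (\<lambda>(i, j). W $$ (i + t, j + t))"
  have "W = four_block_mat K L ?M ?N"
    unfolding K_def L_def using carriers(5) svd_unfold(4) by (intro four_block_mat_split) simp
  thus thesis by (intro that[of ?M ?N]) simp_all
qed

lemma unitary_W: "unitary n W"
  unfolding W_def using svd_unfold by (intro unitary_mult unitary_cadj)

text \<open>This is the top left block of \<open>W * cadj W = 1\<^sub>m n\<close>.\<close>

lemma KL_coisometry: "K * adj K + L * adj L = 1\<^sub>m t"
proof -
  obtain M N where MN: "M \<in> carrier_mat (n - t) t" "N \<in> carrier_mat (n - t) (n - t)"
    "W = four_block_mat K L M N" by (rule W_split)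
  note c = carriers(6,7) MN(1,2)
  have "W * cadj W = four_block_mat (K * cadj K + L * cadj L) (K * cadj M + L * cadj N)
      (M * cadj K + N * cadj L) (M * cadj M + N * cadj N)"
    unfolding MN(3) cadj_four_block_mat[OF c]
    using c by (intro mult_four_block_mat[of _ t t _ "n - t" _ "n - t" _ _ t _ "n - t"]) simp_all
  also have "W * cadj W = four_block_mat (1\<^sub>m t) (0\<^sub>m t (n - t)) (0\<^sub>m (n - t) t) (1\<^sub>m (n - t))"
    using unitaryD(3)[OF unitary_W] svd_unfold(4) by simp
  finally have "four_block_mat (K * cadj K + L * cadj L) (K * cadj M + L * cadj N)
      (M * cadj K + N * cadj L) (M * cadj M + N * cadj N)
    = four_block_mat (1\<^sub>m t) (0\<^sub>m t (n - t)) (0\<^sub>m (n - t) t) (1\<^sub>m (n - t))" by (rule sym)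
  thus ?thesis
    unfolding adj_eq_cadj
    by (rule four_block_mat_top_inject[rotated 4, of _ _ _ _ _ _ _ _ t t "n - t" "n - t"]) (use c in simp_all)
qed

lemma bl_S_mult:
  assumes "M \<in> carrier_mat n n"
  shows "bl S (0\<^sub>m t (n - t)) * M = bl (S * mat t t (\<lambda>(i, j). M $$ (i, j)))
    (S * mat t (n - t) (\<lambda>(i, j). M $$ (i, j + t)))"
proof -
  have M: "M \<in> carrier_mat (t + (n - t)) (t + (n - t))" using assms svd_unfold(4) by simp
  show ?thesis
    by (subst four_block_mat_split[OF M], subst bl_mult) (simp_all add: dc_diag_carrier mult_carrier_mat[OF carriers(8)])
qed

text \<open>Since \<open>cadj V = W * cadj P\<close>, the right unitary factor is traded for the
  adjoint of the left one.\<close>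

lemma A_eq: "A = P * bl (S * K) (S * L) * adj P"
proof -
  have S0: "bl S (0\<^sub>m t (n - t)) \<in> carrier_mat n n" by (rule bl_carrier) (rule carriers)
  have "bl (S * K) (S * L) = bl S (0\<^sub>m t (n - t)) * W"
    unfolding K_def L_def using bl_S_mult[OF carriers(5)] by simp
  thus ?thesis
    unfolding adj_eq_cadj using S0 carriers(1-4) unitaryD(3)[OF svd_unfold(2)] svd_unfold(7)
    by (simp add: W_def assoc_mult_mat[of _ n n _ n _ n])
qed

lemma K_S_invertible:
  "\<exists>Ki. Ki \<in> carrier_mat t t \<and> K * Ki = 1\<^sub>m t \<and> Ki * K = 1\<^sub>m t"
  "\<exists>Si. Si \<in> carrier_mat t t \<and> S * Si = 1\<^sub>m t \<and> Si * S = 1\<^sub>m t"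
proof -
  obtain X where X: "X \<in> carrier_mat n n" "A = A * A * X" using dc_CM_factor(2)[OF CM] by blast
  define S0 where "S0 = bl S (0\<^sub>m t (n - t))"
  have S0: "S0 \<in> carrier_mat n n" unfolding S0_def by (rule bl_carrier) (rule carriers)
  note c = carriers(1-5) S0 X(1)
  \<comment> \<open>Multiplying \<open>A = A * A * X\<close> by \<open>cadj P\<close> on the left
    and by \<open>V\<close> on the right will give \<open>S0 = S0 * W * (S0 * Z)\<close>.\<close>
  define Z where "Z = cadj V * X * V"
  have Z: "Z \<in> carrier_mat n n" using c by (simp add: Z_def)
  note A = svd_unfold(7)[folded S0_def]
  have "S0 = cadj P * A * V"
    unfolding A using c unitary_cancel(1)[OF svd_unfold(2), of _ n] unitaryD(2)[OF svd_unfold(3)]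
    by (simp add: assoc_mult_mat[of _ n n _ n _ n])
  also have "\<dots> = cadj P * (A * A * X) * V" using X(2) by simp
  also have "\<dots> = S0 * W * (S0 * Z)"
    unfolding A using c unitary_cancel(1)[OF svd_unfold(2), of _ n] unitaryD(2)[OF svd_unfold(3)]
    by (simp add: W_def Z_def assoc_mult_mat[of _ n n _ n _ n])
  finally have S0_eq: "S0 = S0 * W * (S0 * Z)" .
  define Z1 where "Z1 = mat t t (\<lambda>(i, j). Z $$ (i, j))"
  define Z2 where "Z2 = mat t (n - t) (\<lambda>(i, j). Z $$ (i, j + t))"
  have Zc: "Z1 \<in> carrier_mat t t" "Z2 \<in> carrier_mat t (n - t)" by (simp_all add: Z1_def Z2_def)
  note c' = carriers(6-8) Zc
  have "bl S (0\<^sub>m t (n - t)) = bl (S * K) (S * L) * bl (S * Z1) (S * Z2)"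
    using S0_eq unfolding S0_def bl_S_mult[OF Z] bl_S_mult[OF carriers(5)] K_def L_def Z1_def Z2_def by simp
  also have "\<dots> = bl (S * K * (S * Z1)) (S * K * (S * Z2))"
    using c' by (intro bl_mult_bl) simp_all
  \<comment> \<open>Also an infinitesimal positive factor can be cancelled up to infinitesimals, so
    \<^term>\<open>K * (S * Z1)\<close> has standard part 1. This rules out infinitesimal singular values.\<close>
  finally have "S = S * K * (S * Z1)"
    by (rule four_block_mat_top_inject[rotated 4, of _ _ _ _ _ _ _ _ t t "n - t" "n - t"])
      (use c' in \<open>simp_all add: mult_carrier_mat[of _ t t _ t]\<close>)
  moreover have "S * K * (S * Z1) = S * (K * (S * Z1))"
    using c' by (simp add: assoc_mult_mat[of _ t t _ t _ t])
  ultimately have "S * (K * (S * Z1)) = S" by simp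
  hence "map_mat std_part (K * (S * Z1)) = 1\<^sub>m t"
    using c' svd_unfold(5) by (intro dc_diag_fixed_std) simp_all
  \<comment> \<open>A determinant with standard part 1 is a unit, and so is each factor of it, in
    particular \<open>det K\<close> and \<open>det S\<close>.\<close>
  hence "std_part (det (K * (S * Z1))) = 1" unfolding std_part_det by simp
  then obtain y where "det (K * (S * Z1)) * y = 1" using complex_dual_unit by (metis zero_neq_one)
  hence "det K * (det S * det Z1 * y) = 1" "det S * (det K * det Z1 * y) = 1"
    using c' by (simp_all add: det_mult[of _ t] mult_ac)
  thus "\<exists>Ki. Ki \<in> carrier_mat t t \<and> K * Ki = 1\<^sub>m t \<and> Ki * K = 1\<^sub>m t"
    "\<exists>Si. Si \<in> carrier_mat t t \<and> S * Si = 1\<^sub>m t \<and> Si * S = 1\<^sub>m t"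
    using mat_invertible_if_det_dvd_one c' by blast+
qed

text \<open>A diagonal entry of an invertible diagonal matrix is a unit, whereas every multiple of
  an infinitesimal has standard part 0.\<close>

lemma appreciable_sv:
  assumes "i < t"
  shows "appreciable (\<mu> i)"
proof -
  obtain Si where Si: "Si \<in> carrier_mat t t" "S * Si = 1\<^sub>m t" using K_S_invertible(2) by blast
  have "(S * Si) $$ (i, i) = dc_of_dual (\<mu> i) * Si $$ (i, i)"
    unfolding dc_diag_def mat_diag_mult_left[OF Si(1)] using assms by simp
  hence "dc_of_dual (\<mu> i) * Si $$ (i, i) = 1" unfolding Si(2) using assms by simp
  thus ?thesis by (auto simp: appreciable_def dual_eq_iff)
qed

lemma invertible_K: "invertible_mat K"
proof -
  obtain Ki where "Ki \<in> carrier_mat t t" "K * Ki = 1\<^sub>m t" "Ki * K = 1\<^sub>m t" using K_S_invertible(1) by blast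
  thus ?thesis using carrier_matD[OF carriers(6)]
    unfolding invertible_mat_def inverts_mat_def square_mat.simps
    by (intro conjI exI[of _ Ki]) simp_all
qed

text \<open>The left side of the trace equation depends on \<open>A\<close> alone, so
  \<open>t\<close> does too.\<close>

lemma group_inverse:
  "dggi A = P * bl (mat_inv K * mat_inv S) (mat_inv K * mat_inv S * mat_inv K * L) * adj P" (is ?inv)
  "mat_trace (A * dggi A) = of_nat t" (is ?tr)
proof -
  obtain Ki where Ki: "Ki \<in> carrier_mat t t" "K * Ki = 1\<^sub>m t" "Ki * K = 1\<^sub>m t" using K_S_invertible(1) by blast
  obtain Si where Si: "Si \<in> carrier_mat t t" "S * Si = 1\<^sub>m t" "Si * S = 1\<^sub>m t" using K_S_invertible(2) by blast
  note c = carriers(6-8) Ki(1) Si(1)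
  have inv: "mat_inv K = Ki" "mat_inv S = Si"
    using Ki Si carrier_matD[OF carriers(6)] carrier_matD[OF carriers(8)]
    by (intro mat_inv_eqI; simp add: inverts_mat_def)+
  have cancel: "Ki * (K * Y) = Y" "K * (Ki * Y) = Y" "S * (Si * Y) = Y" "Si * (S * Y) = Y"
    if Y: "Y \<in> carrier_mat t m" for Y m
  proof -
    note as = assoc_mult_mat[OF _ _ Y, of _ t t, symmetric]
    show "Ki * (K * Y) = Y" "K * (Ki * Y) = Y" "S * (Si * Y) = Y" "Si * (S * Y) = Y"
      using c Ki Si Y by (simp_all add: as)
  qed
  note cancel' = cancel[of _ t] cancel[of _ "n - t"]
  note as = assoc_mult_mat[of _ t t _ t _ t] assoc_mult_mat[of _ t t _ t _ "n - t"]
  define E where "E = bl (S * K) (S * L)"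
  define N where "N = bl (Ki * Si) (Ki * Si * Ki * L)"
  \<comment> \<open>\<open>R\<close> is the idempotent \<open>A * dggi A\<close> seen in the basis
    \<open>P\<close>; both products of \<open>E\<close> and \<open>N\<close> collapse to it.\<close>
  define R where "R = bl (1\<^sub>m t) (Ki * L)"
  have ENR: "E * N = R" "N * E = R" "R * E = E" "R * N = N"
    unfolding E_def N_def R_def using c Ki Si cancel'
    by (simp_all add: bl_mult_bl as)
  have car: "E \<in> carrier_mat n n" "N \<in> carrier_mat n n" "R \<in> carrier_mat n n"
    unfolding E_def N_def R_def using c by (auto intro!: bl_carrier)
  define X where "X = P * N * cadj P"
  note P = carriers(1,2) unitary_cancel(1)[OF svd_unfold(2), of _ n]
  have AE: "A = P * E * cadj P" using A_eq by (simp add: E_def adj_eq_cadj)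
  have AX: "A * X = P * R * cadj P" unfolding AE X_def ENR(1)[symmetric]
    using P car(1,2) by (simp add: assoc_mult_mat[of _ n n _ n _ n])
  have XA: "X * A = P * R * cadj P" unfolding AE X_def ENR(2)[symmetric]
    using P car(1,2) by (simp add: assoc_mult_mat[of _ n n _ n _ n])
  have "A * X * A = P * (R * E) * cadj P" unfolding AX unfolding AE
    using P car by (simp add: assoc_mult_mat[of _ n n _ n _ n])
  moreover have "X * A * X = P * (R * N) * cadj P" unfolding XA unfolding X_def
    using P car by (simp add: assoc_mult_mat[of _ n n _ n _ n])
  ultimately have "is_group_inv A X"
    unfolding is_group_inv_def using AX XA ENR AE carrier_matD[OF svd_unfold(1)] P car
    by (simp add: X_def)
  hence dg: "dggi A = X" by (rule dggi_eqI[OF svd_unfold(1)])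
  show ?inv unfolding inv dg X_def N_def adj_eq_cadj ..
  \<comment> \<open>The block \<open>Ki * L\<close> lies off the diagonal, so the trace of
    \<open>R\<close> counts the \<open>t\<close> ones of its identity block.\<close>
  have "mat_trace (A * dggi A) = mat_trace R"
    unfolding dg AX by (rule mat_trace_unitary_conj[OF svd_unfold(2) car(3)])
  also have "\<dots> = (\<Sum>i<n. if i < t then 1 else 0)"
    unfolding mat_trace_def using car(3) svd_unfold(4) by (intro sum.cong) (auto simp: R_def)
  also have "\<dots> = of_nat (card {i \<in> {..<n}. i < t})" by (simp add: sum.If_cases Int_def)
  also have "{i \<in> {..<n}. i < t} = {..<t}" using svd_unfold(4) by auto
  finally show ?tr by simp
qed

end

section \<open>Existence of the singular value decomposition\<close>

text \<open>First-order expansion of the square root at the standard part, meant for positive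
  standard parts.\<close>

definition dual_sqrt :: "real dual \<Rightarrow> real dual" where
  "dual_sqrt x = Dual (sqrt (std_part x)) (dual_part x / (2 * sqrt (std_part x)))"

lemma dual_sqrt_square: "std_part x > 0 \<Longrightarrow> dual_sqrt x * dual_sqrt x = x"
  by (simp add: dual_eq_iff dual_sqrt_def)

lemma dual_sqrt_pos: "std_part x > 0 \<Longrightarrow> 0 < dual_sqrt x"
  by (simp add: less_dual_def less_eq_dual_def dual_sqrt_def)

lemma dual_sqrt_mono:
  assumes "x \<le> y" "std_part x > 0"
  shows "dual_sqrt x \<le> dual_sqrt y"
  using assms by (auto simp: less_eq_dual_def dual_sqrt_def divide_right_mono)

text \<open>The witness is the first-order expansion of the power -1/2.\<close>

lemma dual_sqrt_inverse:
  assumes "std_part x > 0"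
  shows "\<exists>y. y * dual_sqrt x = 1"
  using assms
  by (intro exI[of _ "Dual (1 / sqrt (std_part x)) (- dual_part x / (2 * sqrt (std_part x) * std_part x))"])
    (simp add: dual_eq_iff dual_sqrt_def field_simps)

text \<open>\<open>Y * R\<close> is a right inverse of the square matrix \<open>K\<close>, hence
  invertible, so \<open>F1 * (Y * R) = 0\<close> already forces \<open>F1\<close> to vanish.\<close>

lemma zero_if_factors_through_right_inverse:
  fixes K Y F1 R :: "'a::comm_ring_1 mat"
  assumes car: "K \<in> carrier_mat r r" "Y \<in> carrier_mat r n" "F1 \<in> carrier_mat m r" "R \<in> carrier_mat n r"
    and GR: "K * Y * R = 1\<^sub>m r" and FR: "F1 * Y * R = 0\<^sub>m m r"
  shows "F1 * Y = 0\<^sub>m m n"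
proof -
  have YR: "Y * R \<in> carrier_mat r r" using car by simp
  have "K * (Y * R) = 1\<^sub>m r" using GR assoc_mult_mat[OF car(1,2,4)] by simp
  hence "(Y * R) * K = 1\<^sub>m r" by (rule mat_mult_left_right_inverse_comm_ring[OF car(1) YR])
  moreover have "F1 * (Y * R) = 0\<^sub>m m r" using FR assoc_mult_mat[OF car(3,2,4)] by simp
  ultimately have "F1 * 1\<^sub>m r = 0\<^sub>m m r * K"
    using assoc_mult_mat[OF car(3) YR car(1)] by simp
  hence "F1 = 0\<^sub>m m r" using car by simp
  thus ?thesis using car by simp
qed

text \<open>Rows from index \<open>r\<close> on have squared norms with standard part 0, so they are
  infinitesimal. By \<open>T = T * (T * Z)\<close> their dual parts are combinations of the first
  \<open>r\<close> rows of the standard part of \<open>T * Z\<close>, and orthogonality to the first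
  \<open>r\<close> rows of \<open>T\<close> makes all coefficients 0.\<close>

lemma infinitesimal_rows_vanish:
  fixes T Z :: "complex dual mat" and l :: "nat \<Rightarrow> real dual"
  assumes T: "T \<in> carrier_mat n n" and Z: "Z \<in> carrier_mat n n" and TTZ: "T = T * (T * Z)"
    and gram: "T * cadj T = dc_diag n l"
    and r: "r \<le> n" "\<And>i. i < n \<Longrightarrow> std_part (l i) > 0 \<longleftrightarrow> i < r"
    and i: "r \<le> i" "i < n" and j: "j < n"
  shows "T $$ (i, j) = 0"
proof -
  have gram_index: "(\<Sum>k<n. T $$ (i, k) * conjugate (T $$ (j, k))) = (if i = j then dc_of_dual (l j) else 0)"
    if "i < n" "j < n" for i j
  proof -
    have "(T * cadj T) $$ (i, j) = (if i = j then dc_of_dual (l j) else 0)" unfolding gram using that by simp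
    thus ?thesis using that carrier_matD[OF T] by (subst (asm) mult_mat_index) simp_all
  qed
  have low: "std_part (T $$ (i, k)) = 0" if ik: "r \<le> i" "i < n" "k < n" for i k
  proof -
    have "(\<Sum>k<n. std_part (T $$ (i, k)) * cnj (std_part (T $$ (i, k)))) = of_real (std_part (l i))"
      using arg_cong[OF gram_index[of i i], of std_part] ik by simp
    hence "(\<Sum>k<n. complex_of_real ((cmod (std_part (T $$ (i, k))))\<^sup>2)) = of_real (std_part (l i))"
      by (simp only: complex_norm_square)
    hence *: "(\<Sum>k<n. (cmod (std_part (T $$ (i, k))))\<^sup>2) = std_part (l i)"
      unfolding of_real_sum[symmetric] of_real_eq_iff .
    have "0 \<le> (\<Sum>k<n. (cmod (std_part (T $$ (i, k))))\<^sup>2)" by (rule sum_nonneg) simp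
    moreover have "\<not> std_part (l i) > 0" using r(2) ik by simp
    ultimately have "(\<Sum>k<n. (cmod (std_part (T $$ (i, k))))\<^sup>2) = 0" using * by linarith
    thus ?thesis using ik by (subst (asm) sum_nonneg_eq_0_iff) auto
  qed
  define TZ where "TZ = T * Z"
  have TZ: "TZ \<in> carrier_mat n n" using T Z by (simp add: TZ_def)
  have T_index: "T $$ (i, j) = (\<Sum>k<n. T $$ (i, k) * TZ $$ (k, j))" if "i < n" "j < n" for i j
    using arg_cong[OF TTZ, of "\<lambda>M. M $$ (i, j)"] that carrier_matD[OF T] carrier_matD[OF TZ]
    unfolding TZ_def[symmetric] by (simp add: mult_mat_index del: index_mult_mat(1))
  have TZ_low: "std_part (TZ $$ (i, j)) = 0" if "r \<le> i" "i < n" "j < n" for i j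
    using that low carrier_matD[OF T] carrier_matD[OF Z]
    unfolding TZ_def by (subst mult_mat_index) simp_all
  have trunc: "(\<Sum>k<n. f k * std_part (TZ $$ (k, j))) = (\<Sum>k<r. f k * std_part (TZ $$ (k, j)))"
    if "j < n" for f j
    using r(1) TZ_low that by (intro sum.mono_neutral_right) auto
  \<comment> \<open>\<open>K * Y\<close> will be the standard part of the top rows of
    \<open>T\<close>, \<open>F1 * Y\<close> the dual part of the bottom rows, and \<open>R\<close>
    is the adjoint of those top rows, scaled to be a right inverse.\<close>
  define K Y F1 R where "K = mat r r (\<lambda>(i, j). std_part (T $$ (i, j)))"
    and "Y = mat r n (\<lambda>(i, j). std_part (TZ $$ (i, j)))"
    and "F1 = mat (n - r) r (\<lambda>(i, j). dual_part (T $$ (i + r, j)))"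
    and "R = mat n r (\<lambda>(i, j). cnj (std_part (T $$ (j, i))) / of_real (std_part (l j)))"
  note defs = K_def Y_def F1_def R_def
  have car: "K \<in> carrier_mat r r" "Y \<in> carrier_mat r n" "F1 \<in> carrier_mat (n - r) r" "R \<in> carrier_mat n r"
    by (simp_all add: defs)
  have KY: "(K * Y) $$ (i, j) = std_part (T $$ (i, j))" if "i < r" "j < n" for i j
    using that r(1) arg_cong[OF T_index[of i j], of std_part] trunc[of j]
    by (subst mult_mat_index) (simp_all add: defs)
  have FY: "(F1 * Y) $$ (i, j) = dual_part (T $$ (i + r, j))" if "i < n - r" "j < n" for i j
    using that r(1) arg_cong[OF T_index[of "i + r" j], of dual_part] trunc[of j] low[of "i + r"]
    by (subst mult_mat_index) (simp_all add: defs)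
  have "K * Y * R = 1\<^sub>m r"
  proof (rule eq_matI)
    fix i j assume "i < dim_row (1\<^sub>m r)" "j < dim_col (1\<^sub>m r)"
    hence ij: "i < r" "j < r" by auto
    have "(K * Y * R) $$ (i, j) = (\<Sum>k<n. (K * Y) $$ (i, k) * R $$ (k, j))"
      using ij car by (subst mult_mat_index) auto
    also have "\<dots> = (\<Sum>k<n. std_part (T $$ (i, k)) * cnj (std_part (T $$ (j, k)))) / of_real (std_part (l j))"
      unfolding sum_divide_distrib using ij KY by (intro sum.cong) (simp_all add: R_def)
    also have "\<dots> = (if i = j then 1 else 0)"
      using arg_cong[OF gram_index[of i j], of std_part] ij r(1) r(2)[of j] by simp
    finally show "(K * Y * R) $$ (i, j) = 1\<^sub>m r $$ (i, j)" using ij by simp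
  qed (simp_all add: defs)
  moreover have "F1 * Y * R = 0\<^sub>m (n - r) r"
  proof (rule eq_matI)
    fix i j assume "i < dim_row (0\<^sub>m (n - r) r)" "j < dim_col (0\<^sub>m (n - r) r)"
    hence ij: "i < n - r" "j < r" by auto
    have "(F1 * Y * R) $$ (i, j) = (\<Sum>k<n. (F1 * Y) $$ (i, k) * R $$ (k, j))"
      using ij car by (subst mult_mat_index) auto
    also have "\<dots> = (\<Sum>k<n. dual_part (T $$ (i + r, k)) * cnj (std_part (T $$ (j, k)))) / of_real (std_part (l j))"
      unfolding sum_divide_distrib using ij FY by (intro sum.cong) (simp_all add: R_def)
    \<comment> \<open>The bottom rows have standard part 0, so this sum is the dual part of an
      off-diagonal Gram entry.\<close>
    also have "\<dots> = 0"
      using arg_cong[OF gram_index[of "i + r" j], of dual_part] ij r(1) low[of "i + r"] by simp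
    finally show "(F1 * Y * R) $$ (i, j) = 0\<^sub>m (n - r) r $$ (i, j)" using ij by simp
  qed (simp_all add: defs)
  ultimately have "F1 * Y = 0\<^sub>m (n - r) n"
    by (rule zero_if_factors_through_right_inverse[OF car])
  hence "dual_part (T $$ (i, j)) = 0" using FY[of "i - r" j] i j by simp
  thus ?thesis using low[OF i j] by (simp add: dual_eq_iff)
qed

lemma four_block_diag_zero:
  assumes "t \<le> n"
  shows "four_block_mat (dc_diag t \<mu>) (0\<^sub>m t (n - t)) (0\<^sub>m (n - t) t) (0\<^sub>m (n - t) (n - t))
    = mat_diag n (\<lambda>i. if i < t then dc_of_dual (\<mu> i) else 0)"
  using assms carrier_matD[OF dc_diag_carrier[of t \<mu>]] by (intro eq_matI) (auto simp: mat_diag_def)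

theorem CM_dual_svd_exists:
  assumes CM: "A \<in> dc_CM n"
  shows "\<exists>r P \<mu> V. is_dual_svd A P r \<mu> V"
proof -
  note A = dc_CM_factor(1)[OF CM]
  obtain X where X: "X \<in> carrier_mat n n" "A = A * A * X" using dc_CM_factor(2)[OF CM] by blast
  have A': "cadj A \<in> carrier_mat n n" using A by simp
  have "cadj (A * cadj A) = A * cadj A" using A A' by (simp add: cadj_mult[of _ n n _ n])
  then obtain P l where P: "unitary n P" and sorted: "\<forall>i j. i \<le> j \<and> j < n \<longrightarrow> l j \<le> l i"
    and PH: "A * cadj A = P * dc_diag n l * cadj P"
    using dual_hermitian_spectral[of "A * cadj A" n] A A' by auto
  note Pc = unitaryD[OF P]
  have P': "cadj P \<in> carrier_mat n n" using Pc by simp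
  \<comment> \<open>In the eigenbasis \<open>P\<close> of \<open>A * cadj A\<close> the rows of
    \<open>T\<close> are pairwise orthogonal with squared norms \<open>l i\<close>, and
    \<open>A = A * A * X\<close> keeps its form.\<close>
  define T Z where "T = cadj P * A * P" and "Z = cadj P * X * P"
  have T: "T \<in> carrier_mat n n" and Z: "Z \<in> carrier_mat n n" using A X Pc P' by (simp_all add: T_def Z_def)
  note c = A A' X(1) Pc(1) P' unitary_cancel[OF P, of _ n]
  have cT: "cadj T = cadj P * cadj A * P"
    unfolding T_def using c by (simp add: cadj_mult[of _ n n _ n] assoc_mult_mat[of _ n n _ n _ n])
  have "T * cadj T = cadj P * (A * cadj A) * P"
    unfolding cT unfolding T_def using c by (simp add: assoc_mult_mat[of _ n n _ n _ n])
  also have "\<dots> = dc_diag n l"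
    using iffD1[OF unitary_conj_diag_iff[OF P mult_carrier_mat[OF A A'] dc_diag_carrier] PH] .
  finally have gram: "T * cadj T = dc_diag n l" .
  have "T = cadj P * (A * A * X) * P" using X(2) by (simp add: T_def)
  also have "\<dots> = T * (T * Z)"
    unfolding T_def Z_def using c by (simp add: assoc_mult_mat[of _ n n _ n _ n])
  finally have TTZ: "T = T * (T * Z)" .
  have "std_part (l i) > 0" if "i \<le> j" "j < n" "std_part (l j) > 0" for i j
    using that sorted by (force simp: less_eq_dual_def)
  then obtain r where r: "r \<le> n" "\<And>i. i < n \<Longrightarrow> std_part (l i) > 0 \<longleftrightarrow> i < r"
    using ex_threshold[of n "\<lambda>i. std_part (l i) > 0"] by blast
  have T0: "T $$ (i, j) = 0" if "r \<le> i" "i < n" "j < n" for i j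
    using infinitesimal_rows_vanish[OF T Z TTZ gram r] that by blast
  \<comment> \<open>The singular values are the roots of the leading \<open>l i\<close>;
    \<open>\<nu> i\<close> is the reciprocal that normalises row \<open>i\<close> for
    \<open>i < r\<close>.\<close>
  define \<mu> where "\<mu> i = dual_sqrt (l i)" for i
  define \<nu> where "\<nu> i = (SOME y. y * \<mu> i = 1)" for i
  have pos: "std_part (l i) > 0" if "i < r" for i using r that by simp
  have \<nu>: "\<nu> i * \<mu> i = 1" if "i < r" for i
    unfolding \<nu>_def using dual_sqrt_inverse[OF pos[OF that]] unfolding \<mu>_def by (rule someI_ex)
  have \<nu>\<nu>: "\<nu> i * \<nu> i * l i = 1" if "i < r" for i
  proof -
    have "\<nu> i * \<nu> i * (\<mu> i * \<mu> i) = (\<nu> i * \<mu> i) * (\<nu> i * \<mu> i)" by (simp only: mult_ac)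
    thus ?thesis using \<nu>[OF that] dual_sqrt_square[OF pos[OF that]] by (simp add: \<mu>_def)
  qed
  define Q where "Q = mat r n (\<lambda>(i, j). dc_of_dual (\<nu> i) * T $$ (i, j))"
  have Q: "Q \<in> carrier_mat r n" by (simp add: Q_def)
  have "Q * cadj Q = 1\<^sub>m r"
  proof (rule eq_matI)
    fix i j assume "i < dim_row (1\<^sub>m r)" "j < dim_col (1\<^sub>m r)"
    hence ij: "i < r" "j < r" by auto
    have "(T * cadj T) $$ (i, j) = (if i = j then dc_of_dual (l j) else 0)" unfolding gram using ij r by simp
    hence g: "(\<Sum>k<n. T $$ (i, k) * conjugate (T $$ (j, k))) = (if i = j then dc_of_dual (l j) else 0)"
      using ij r carrier_matD[OF T] by (subst (asm) mult_mat_index) simp_all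
    have "(Q * cadj Q) $$ (i, j) = (\<Sum>k<n. dc_of_dual (\<nu> i) * dc_of_dual (\<nu> j) * (T $$ (i, k) * conjugate (T $$ (j, k))))"
      using ij by (subst mult_mat_index) (simp_all add: Q_def conjugate_dist_mul mult_ac)
    also have "\<dots> = dc_of_dual (\<nu> i * \<nu> j) * (\<Sum>k<n. T $$ (i, k) * conjugate (T $$ (j, k)))"
      by (simp add: sum_distrib_left)
    also have "\<dots> = (if i = j then dc_of_dual (\<nu> j * \<nu> j * l j) else 0)" unfolding g by simp
    also have "\<dots> = 1\<^sub>m r $$ (i, j)" using ij \<nu>\<nu>[of j] by (simp del: dc_of_dual_simps(1))
    finally show "(Q * cadj Q) $$ (i, j) = 1\<^sub>m r $$ (i, j)" .
  qed (simp_all add: Q_def)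
  then obtain V where V: "unitary n V" and VQ: "\<And>i j. i < r \<Longrightarrow> j < n \<Longrightarrow> cadj V $$ (i, j) = Q $$ (i, j)"
    using coisometry_extend_unitary[OF Q] by blast
  note Vc = unitaryD[OF V]
  have V': "cadj V \<in> carrier_mat n n" using Vc by simp
  define D where "D = mat_diag n (\<lambda>i. if i < r then dc_of_dual (\<mu> i) else 0)"
  have D: "D \<in> carrier_mat n n" by (simp add: D_def)
  \<comment> \<open>Rows before \<open>r\<close> agree because \<open>\<nu> i * \<mu> i = 1\<close>;
    the others vanish on both sides.\<close>
  have "T = D * cadj V"
    unfolding D_def mat_diag_mult_left[OF V']
  proof (rule eq_matI)
    fix i j assume "i < dim_row (mat n n (\<lambda>(i, j). (if i < r then dc_of_dual (\<mu> i) else 0) * cadj V $$ (i, j)))"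
      "j < dim_col (mat n n (\<lambda>(i, j). (if i < r then dc_of_dual (\<mu> i) else 0) * cadj V $$ (i, j)))"
    hence ij: "i < n" "j < n" by auto
    have "dc_of_dual (\<mu> i) * (dc_of_dual (\<nu> i) * T $$ (i, j)) = T $$ (i, j)" if "i < r"
    proof -
      have "dc_of_dual (\<mu> i) * (dc_of_dual (\<nu> i) * T $$ (i, j)) = dc_of_dual (\<nu> i * \<mu> i) * T $$ (i, j)"
        by (simp add: mult_ac)
      thus ?thesis using \<nu>[OF that] by (simp del: dc_of_dual_simps(1))
    qed
    thus "T $$ (i, j) = mat n n (\<lambda>(i, j). (if i < r then dc_of_dual (\<mu> i) else 0) * cadj V $$ (i, j)) $$ (i, j)"
      using ij T0[of i j] VQ[of i j] by (simp add: Q_def del: cadj_index)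
  qed (use T in simp_all)
  hence "A = P * (D * cadj V) * cadj P"
    using unitary_conj_diag_iff[OF P A T] by (simp add: T_def)
  \<comment> \<open>The factor \<open>cadj P\<close> left over from the change of basis merges with
    \<open>cadj V\<close> into the adjoint of \<open>P * V\<close>.\<close>
  also have "\<dots> = P * D * cadj (P * V)"
    using c V' Vc(1) D by (simp add: cadj_mult[of _ n n _ n] assoc_mult_mat[of _ n n _ n _ n])
  finally have "A = P * D * adj (P * V)" by (simp add: adj_eq_cadj)
  moreover have "\<mu> j \<le> \<mu> i" if "i \<le> j" "j < r" for i j
    unfolding \<mu>_def using that sorted r(1) pos by (intro dual_sqrt_mono) auto
  moreover have "0 < \<mu> i" if "i < r" for i unfolding \<mu>_def using pos[OF that] by (rule dual_sqrt_pos)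
  ultimately have "is_dual_svd A P r \<mu> (P * V)"
    unfolding is_dual_svd_def Let_def carrier_matD[OF A] dc_unitary_iff four_block_diag_zero[OF r(1)] D_def
    using P unitary_mult[OF P V] r(1) by blast
  thus ?thesis by blast
qed

section \<open>Uniqueness of the rank and the block form of the group inverse\<close>

theorem theorem4p8:
  fixes A :: "complex dual mat" and n r :: nat
  assumes "A \<in> dc_CM n"
    and "r = dual_rank A"
  shows "r \<le> n \<and>
    (\<exists>U K L \<mu>.
       U \<in> dc_unitary n \<and>
       K \<in> carrier_mat r r \<and> invertible_mat K \<and>
       L \<in> carrier_mat r (n - r) \<and>
       K * adj K + L * adj L = 1\<^sub>m r \<and>
       (\<forall>i<r. 0 < \<mu> i \<and> appreciable (\<mu> i)) \<and>
       (\<forall>i j. i \<le> j \<and> j < r \<longrightarrow> \<mu> j \<le> \<mu> i) \<and>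
       A = U * four_block_mat (dc_diag r \<mu> * K) (dc_diag r \<mu> * L)
                              (0\<^sub>m (n - r) r) (0\<^sub>m (n - r) (n - r)) * adj U \<and>
       dggi A = U * four_block_mat (mat_inv K * mat_inv (dc_diag r \<mu>))
                                   (mat_inv K * mat_inv (dc_diag r \<mu>) * mat_inv K * L)
                                   (0\<^sub>m (n - r) r) (0\<^sub>m (n - r) (n - r)) * adj U)"
proof -
  obtain t P \<mu> V where svd: "is_dual_svd A P t \<mu> V" using CM_dual_svd_exists[OF assms(1)] by blast
  \<comment> \<open>Any two decompositions give the same trace, hence the same number of singular
    values; so the description in \<open>dual_rank\<close> has exactly one solution.\<close>
  have trace: "mat_trace (A * dggi A) = of_nat s" if "is_dual_svd A P' s \<mu>' V'" for P' s \<mu>' V'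
    by (rule CM_svd.group_inverse(2)[OF CM_svd.intro[OF assms(1) that]])
  have "s = t" if "is_dual_svd A P' s \<mu>' V'" for P' s \<mu>' V'
    using trace[OF that] trace[OF svd] by (simp add: of_nat_dual_inject)
  hence "dual_rank A = t" unfolding dual_rank_def using svd by (intro the_equality) blast+
  hence r: "r = t" using assms(2) by simp
  interpret CM_svd A P V n t \<mu> using assms(1) svd by unfold_locales
  show ?thesis
    unfolding r dc_unitary_iff
    using svd_unfold(2,4,5,6) carriers(6,7) invertible_K KL_coisometry appreciable_sv A_eq group_inverse(1)
    by blast
qed

end
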